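(* There are absolute constants $C, C'>0$ such that for every non-constant function $f\colon\{0,1\}^n\to\{0,1\}$ there is a non-empty $S\subseteq[n]$ with $|S|\leq C'\,\tilde{I}[f]$ and \[ |\widehat{f}(S)|\geq 2^{-C\cdot |S|\log(1+\tilde{I}[f])}\sqrt{\mathrm{var}(f)} . \] In particular, $H_{\infty}[\widehat f]\leq O\big(\tilde{I}[f]\log(1+\tilde{I}[f])\big)$, where the implied constant is absolute.
   Context: $\{0,1\}^n$ carries the uniform measure; $\langle f,g\rangle=\mathbb{E}_x[f(x)g(x)]$, $\|f\|_2=\langle f,f\rangle^{1/2}$. For $S\subseteq[n]$, $\chi_S(x)=(-1)^{\sum_{i\in S}x_i}$ and $\widehat f(S)=\langle f,\chi_S\rangle$, so $f=\sum_S\widehat f(S)\chi_S$. The total influence is $I[f]=\sum_{S}|S|\widehat f(S)^2$ (equivalently $\sum_i\|\partial_i f\|_2^2$ with $\partial_i f=\frac12(f_{i\to0}-f_{i\to1})$; using instead $\sum_i\Pr_x[f(x)\ne f(x\oplus e_i)]$ only changes $I[f]$ by a factor $4$). $\mathrm{var}(f)=\mathbb{E}[f^2]-\mathbb{E}[f]^2$ and $\tilde I[f]=I[f]/\mathrm{var}(f)$. The Fourier min-entropy is $H_\infty[\widehat f]=\min_{S\subseteq[n]}\log(1/\widehat f(S)^2)$. $\log$ is the natural logarithm. *)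

theory Defs
  imports "HOL-Analysis.Analysis"
begin

definition bcube :: "nat \<Rightarrow> (nat \<Rightarrow> nat) set" where
  "bcube n = ({1..n} \<rightarrow>\<^sub>E {0, 1})"

definition cube_mean :: "nat \<Rightarrow> ((nat \<Rightarrow> nat) \<Rightarrow> real) \<Rightarrow> real" where
  "cube_mean n f = (\<Sum>x\<in>bcube n. f x) / real (card (bcube n))"

definition cube_inner :: "nat \<Rightarrow> ((nat \<Rightarrow> nat) \<Rightarrow> real) \<Rightarrow> ((nat \<Rightarrow> nat) \<Rightarrow> real) \<Rightarrow> real" where
  "cube_inner n f g = cube_mean n (\<lambda>x. f x * g x)"

definition walsh :: "nat set \<Rightarrow> (nat \<Rightarrow> nat) \<Rightarrow> real" where
  "walsh S x = (- 1) ^ (\<Sum>i\<in>S. x i)"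

definition fourier_coeff :: "nat \<Rightarrow> ((nat \<Rightarrow> nat) \<Rightarrow> real) \<Rightarrow> nat set \<Rightarrow> real" where
  "fourier_coeff n f S = cube_inner n f (walsh S)"

definition total_influence :: "nat \<Rightarrow> ((nat \<Rightarrow> nat) \<Rightarrow> real) \<Rightarrow> real" where
  "total_influence n f = (\<Sum>S\<in>Pow {1..n}. real (card S) * (fourier_coeff n f S)\<^sup>2)"

definition cube_var :: "nat \<Rightarrow> ((nat \<Rightarrow> nat) \<Rightarrow> real) \<Rightarrow> real" where
  "cube_var n f = cube_mean n (\<lambda>x. (f x)\<^sup>2) - (cube_mean n f)\<^sup>2"

definition norm_influence :: "nat \<Rightarrow> ((nat \<Rightarrow> nat) \<Rightarrow> real) \<Rightarrow> real" where
  "norm_influence n f = total_influence n f / cube_var n f"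

text \<open>Vanishing Fourier coefficients contribute \<open>log (1 / 0) = \<infinity>\<close> to the minimum, whereas
  \<open>ln (1 / 0) = 0\<close> for reals in HOL; hence the case distinction and the extended reals.\<close>

definition log_recip :: "real \<Rightarrow> ereal" where
  "log_recip a = (if a = 0 then \<infinity> else ereal (ln (1 / a)))"

definition fourier_min_entropy :: "nat \<Rightarrow> ((nat \<Rightarrow> nat) \<Rightarrow> real) \<Rightarrow> ereal" where
  "fourier_min_entropy n f = Min ((\<lambda>S. log_recip ((fourier_coeff n f S)\<^sup>2)) ` Pow {1..n})"

end

theory Submission
  imports Defs
begin

text \<open>
  Write \<open>N\<close> for the normalised influence. Suppose that all coefficients at the levels \<open>1, \<dots>, 2N\<close>,
  which carry half of the variance, are tiny. The contradiction comes from a bound on the Renyi-type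
  sums \<open>\<Sum> \<bar>f(S)\<bar> powr (2 - 2a)\<close> over \<open>1 \<le> \<bar>S\<bar> \<le> k\<close> with \<open>a\<close> of order \<open>1 / k\<close>, by \<open>poly(k) * I powr (1 - a)\<close>
  for every two-valued function of influence \<open>I\<close>; it is proved by doubling \<open>k\<close>.

  For \<open>k = 1\<close> it follows from \<open>\<Sum> \<bar>f({i})\<bar> \<le> 2I\<close>, since discrete derivatives of \<open>f\<close> take only the values
  \<open>0\<close> and \<open>\<plusminus> 1/2\<close>. In the doubling step a random partition \<open>V = A \<union> B\<close> cuts a constant
  fraction of the sets \<open>S\<close> nearly in half. Subadditivity of Renyi entropy bounds the sum
  over pairs \<open>(S \<inter> A, S \<inter> B)\<close> by the sums over the two marginals. By hypercontractivity, at the cost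
  of a factor \<open>9 powr (k * b)\<close> that stays bounded for \<open>b\<close> of order \<open>1 / k\<close>, the marginal on \<open>A\<close> is
  dominated by the average of the corresponding sums of the restrictions of \<open>f\<close> to \<open>A\<close>, to which the
  induction hypothesis applies. No bound on the tail of the Fourier spectrum is needed beyond the
  influence itself.

  Points of the cube over a finite set \<open>V\<close> are the subsets of \<open>V\<close>.
\<close>

section \<open>Hoelder inequalities and subadditivity of Renyi entropy\<close>

text \<open>After normalising both sums to 1, Hoelder's inequality is the sum over \<open>x\<close>
  of the weighted AM-GM inequalities for the single terms.\<close>

lemma Holder_sum2:
  fixes u v :: "'a \<Rightarrow> real"
  assumes "0 \<le> \<alpha>" "0 \<le> \<beta>" "\<alpha> + \<beta> = 1" "finite A"
    and u: "\<And>x. x \<in> A \<Longrightarrow> 0 \<le> u x" and v: "\<And>x. x \<in> A \<Longrightarrow> 0 \<le> v x"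
  shows "(\<Sum>x\<in>A. u x powr \<alpha> * v x powr \<beta>) \<le> (\<Sum>x\<in>A. u x) powr \<alpha> * (\<Sum>x\<in>A. v x) powr \<beta>"
proof -
  define U where "U = (\<Sum>x\<in>A. u x)"
  define V where "V = (\<Sum>x\<in>A. v x)"
  have "U \<ge> 0" "V \<ge> 0" unfolding U_def V_def using u v by (auto intro: sum_nonneg)
  show ?thesis
  proof (cases "U = 0 \<or> V = 0")
    case True
    then have "(\<forall>x\<in>A. u x = 0) \<or> (\<forall>x\<in>A. v x = 0)"
      unfolding U_def V_def using u v \<open>finite A\<close> by (simp add: sum_nonneg_eq_0_iff)
    \<comment> \<open>This covers zero exponents too, because \<open>0 powr 0 = 0\<close>.\<close>
    then have "(\<Sum>x\<in>A. u x powr \<alpha> * v x powr \<beta>) = 0"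
      by (auto intro!: sum.neutral)
    then show ?thesis by simp
  next
    case False
    with \<open>U \<ge> 0\<close> \<open>V \<ge> 0\<close> have pos: "U > 0" "V > 0" by auto
    have young: "u x powr \<alpha> * v x powr \<beta> \<le> U powr \<alpha> * V powr \<beta> * (\<alpha> * (u x / U) + \<beta> * (v x / V))"
      if "x \<in> A" for x
    proof (cases "u x = 0 \<or> v x = 0")
      case True
      then have "u x powr \<alpha> * v x powr \<beta> = 0" by auto
      also have "0 \<le> U powr \<alpha> * V powr \<beta> * (\<alpha> * (u x / U) + \<beta> * (v x / V))"
        using pos assms that by (intro mult_nonneg_nonneg add_nonneg_nonneg) auto
      finally show ?thesis .
    next
      case False
      with u v that have "u x > 0" "v x > 0" by (metis less_eq_real_def)+
      then have "(u x / U) powr \<alpha> * (v x / V) powr \<beta> \<le> \<alpha> * (u x / U) + \<beta> * (v x / V)"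
        using pos assms by (intro Youngs_inequality_0) auto
      moreover have "u x powr \<alpha> * v x powr \<beta> = U powr \<alpha> * V powr \<beta> * ((u x / U) powr \<alpha> * (v x / V) powr \<beta>)"
        using pos \<open>u x > 0\<close> \<open>v x > 0\<close> by (simp add: powr_divide)
      ultimately show ?thesis
        using pos by (simp add: mult_left_mono)
    qed
    have "(\<Sum>x\<in>A. u x powr \<alpha> * v x powr \<beta>)
        \<le> (\<Sum>x\<in>A. U powr \<alpha> * V powr \<beta> * (\<alpha> * (u x / U) + \<beta> * (v x / V)))"
      by (intro sum_mono young)
    also have "\<dots> = U powr \<alpha> * V powr \<beta> * (\<alpha> * (U / U) + \<beta> * (V / V))"
      by (simp only: U_def V_def sum_distrib_left [symmetric] sum.distrib sum_divide_distrib)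
    also have "\<dots> = U powr \<alpha> * V powr \<beta>" using pos assms by simp
    finally show ?thesis unfolding U_def V_def .
  qed
qed

text \<open>The first two factors are merged into \<open>z\<close> with the relative weights
  \<open>\<alpha> / s\<close> and \<open>\<beta> / s\<close>; two applications of the two-factor
  inequality then suffice. The strict bound on \<open>\<beta>\<close> keeps \<open>s\<close>
  positive.\<close>

lemma Holder_sum3:
  fixes u v w :: "'a \<Rightarrow> real"
  assumes "0 \<le> \<alpha>" "0 < \<beta>" "0 \<le> \<gamma>" "\<alpha> + \<beta> + \<gamma> = 1" "finite A"
    and u: "\<And>x. x \<in> A \<Longrightarrow> 0 \<le> u x" and v: "\<And>x. x \<in> A \<Longrightarrow> 0 \<le> v x"
    and w: "\<And>x. x \<in> A \<Longrightarrow> 0 \<le> w x"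
  shows "(\<Sum>x\<in>A. u x powr \<alpha> * v x powr \<beta> * w x powr \<gamma>)
      \<le> (\<Sum>x\<in>A. u x) powr \<alpha> * (\<Sum>x\<in>A. v x) powr \<beta> * (\<Sum>x\<in>A. w x) powr \<gamma>"
proof -
  define s where "s = \<alpha> + \<beta>"
  have s: "s > 0" "s + \<gamma> = 1" using assms by (auto simp: s_def)
  define z where "z x = u x powr (\<alpha> / s) * v x powr (\<beta> / s)" for x
  have z: "z x powr s = u x powr \<alpha> * v x powr \<beta>" for x
    using s by (simp add: z_def powr_mult powr_powr)
  have "(\<Sum>x\<in>A. u x powr \<alpha> * v x powr \<beta> * w x powr \<gamma>) = (\<Sum>x\<in>A. z x powr s * w x powr \<gamma>)"
    by (simp add: z)
  also have "\<dots> \<le> (\<Sum>x\<in>A. z x) powr s * (\<Sum>x\<in>A. w x) powr \<gamma>"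
    using assms s by (intro Holder_sum2) (auto simp: z_def)
  also have "(\<Sum>x\<in>A. z x) \<le> (\<Sum>x\<in>A. u x) powr (\<alpha> / s) * (\<Sum>x\<in>A. v x) powr (\<beta> / s)"
    unfolding z_def using assms s
    by (intro Holder_sum2) (auto simp: s_def simp flip: add_divide_distrib)
  then have "(\<Sum>x\<in>A. z x) powr s
      \<le> ((\<Sum>x\<in>A. u x) powr (\<alpha> / s) * (\<Sum>x\<in>A. v x) powr (\<beta> / s)) powr s"
    using s by (intro powr_mono2) (auto simp: z_def intro: sum_nonneg)
  also have "\<dots> = (\<Sum>x\<in>A. u x) powr \<alpha> * (\<Sum>x\<in>A. v x) powr \<beta>"
    using s by (simp add: powr_mult powr_powr)
  finally show ?thesis by (simp add: mult_right_mono)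
qed

text \<open>With \<open>Q\<close>, \<open>R\<close> the marginals of \<open>P\<close> and
  \<open>s = b / 2\<close>, Hoelder is applied to the factorisation of \<open>P powr (1 - a)\<close>
  into powers of \<open>P * (Q * R) powr (- s)\<close> and of \<open>(Q * R) powr (1 - b)\<close>.
  The value of \<open>b\<close> is the one for which the powers of the marginals cancel. Both sides
  are homogeneous of degree \<open>1 - a\<close> in \<open>P\<close>.\<close>

lemma Renyi_subadditivity:
  fixes P :: "'a \<Rightarrow> 'b \<Rightarrow> real"
  assumes "finite A" "finite B" and P: "\<And>x y. x \<in> A \<Longrightarrow> y \<in> B \<Longrightarrow> 0 \<le> P x y"
    and a: "0 < a" "a < 1" and b: "b = 2 * a / (1 + a)"
  shows "(\<Sum>x\<in>A. \<Sum>y\<in>B. P x y powr (1 - a))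
    \<le> ((\<Sum>x\<in>A. (\<Sum>y\<in>B. P x y) powr (1 - b)) * (\<Sum>y\<in>B. (\<Sum>x\<in>A. P x y) powr (1 - b))) powr ((1 + a) / 2)"
proof -
  define Q where "Q x = (\<Sum>y\<in>B. P x y)" for x
  define R where "R y = (\<Sum>x\<in>A. P x y)" for y
  define ZQ where "ZQ = (\<Sum>x\<in>A. Q x powr (1 - b))"
  define ZR where "ZR = (\<Sum>y\<in>B. R y powr (1 - b))"
  have nn: "ZQ \<ge> 0" "ZR \<ge> 0" by (auto simp: ZQ_def ZR_def intro: sum_nonneg)
  \<comment> \<open>Where \<open>P\<close> is positive, so are both marginals, and their negative
    powers may be cancelled.\<close>
  have QR: "Q x \<ge> P x y" "R y \<ge> P x y" if "x \<in> A" "y \<in> B" for x y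
    unfolding Q_def R_def using assms that
    by (auto intro: member_le_sum[where f="P x"] member_le_sum[where f="\<lambda>x. P x y"])
  have Q0: "Q x \<ge> 0" if "x \<in> A" for x using that P by (auto simp: Q_def intro: sum_nonneg)
  have R0: "R y \<ge> 0" if "y \<in> B" for y using that P by (auto simp: R_def intro: sum_nonneg)
  define s where "s = b / 2"
  have sa: "s * (1 - a) = a * (1 - b)" using a unfolding s_def b by (simp add: field_simps)
  define M where "M p = P (fst p) (snd p) * Q (fst p) powr (- s) * R (snd p) powr (- s)" for p
  define N where "N p = Q (fst p) powr (1 - b) * R (snd p) powr (1 - b)" for p
  have P0: "0 \<le> P (fst p) (snd p)" if "p \<in> A \<times> B" for p using that P by auto
  have eq: "P (fst p) (snd p) powr (1 - a) = M p powr (1 - a) * N p powr a" if "p \<in> A \<times> B" for p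
  proof (cases "P (fst p) (snd p) = 0")
    case True
    then show ?thesis by (simp add: M_def)
  next
    case False
    with P0[OF that] have pos: "P (fst p) (snd p) > 0" by simp
    with QR[of "fst p" "snd p"] that have pos': "Q (fst p) > 0" "R (snd p) > 0" by auto
    have exp: "- s * (1 - a) + (1 - b) * a = 0" using sa by (simp add: algebra_simps)
    have "M p powr (1 - a) * N p powr a
        = P (fst p) (snd p) powr (1 - a) * (Q (fst p) powr (- s * (1 - a)) * Q (fst p) powr ((1 - b) * a))
          * (R (snd p) powr (- s * (1 - a)) * R (snd p) powr ((1 - b) * a))"
      unfolding M_def N_def using pos pos' by (simp add: powr_mult powr_powr)
    also have "\<dots> = P (fst p) (snd p) powr (1 - a)"
      using pos' exp by (simp flip: powr_add)
    finally show ?thesis by simp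
  qed
  have M0: "M p \<ge> 0" if "p \<in> A \<times> B" for p using P0[OF that] by (simp add: M_def)
  \<comment> \<open>Cauchy-Schwarz: \<open>M\<close> is the geometric mean of
    \<open>P * Q powr (- b)\<close> and \<open>P * R powr (- b)\<close>, and summing out the other
    variable turns these into the terms of \<open>ZQ\<close> and \<open>ZR\<close>.\<close>
  have half: "(\<Sum>p\<in>A \<times> B. M p) \<le> ZQ powr (1/2) * ZR powr (1/2)"
  proof -
    have eqM: "M p = (P (fst p) (snd p) * Q (fst p) powr (- b)) powr (1/2)
                   * (P (fst p) (snd p) * R (snd p) powr (- b)) powr (1/2)" if "p \<in> A \<times> B" for p
    proof -
      have "P (fst p) (snd p) powr (1/2) * P (fst p) (snd p) powr (1/2) = P (fst p) (snd p)"
        using P0[OF that] by (simp flip: powr_add)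
      then show ?thesis
        unfolding M_def s_def using P0[OF that]
        by (simp add: powr_mult powr_powr algebra_simps)
    qed
    have "(\<Sum>p\<in>A \<times> B. M p) = (\<Sum>p\<in>A \<times> B. (P (fst p) (snd p) * Q (fst p) powr (- b)) powr (1/2)
                   * (P (fst p) (snd p) * R (snd p) powr (- b)) powr (1/2))"
      by (intro sum.cong eqM) auto
    also have "\<dots> \<le> (\<Sum>p\<in>A \<times> B. P (fst p) (snd p) * Q (fst p) powr (- b)) powr (1/2)
                 * (\<Sum>p\<in>A \<times> B. P (fst p) (snd p) * R (snd p) powr (- b)) powr (1/2)"
      using assms P0 by (intro Holder_sum2) auto
    also have "(\<Sum>p\<in>A \<times> B. P (fst p) (snd p) * Q (fst p) powr (- b)) = ZQ"
    proof -
      have "(\<Sum>p\<in>A \<times> B. P (fst p) (snd p) * Q (fst p) powr (- b))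
          = (\<Sum>x\<in>A. \<Sum>y\<in>B. P x y * Q x powr (- b))"
        by (simp add: sum.cartesian_product case_prod_unfold)
      also have "\<dots> = (\<Sum>x\<in>A. Q x * Q x powr (- b))"
        by (simp add: Q_def sum_distrib_right)
      also have "\<dots> = ZQ"
        unfolding ZQ_def using Q0 by (intro sum.cong) (auto simp: powr_mult_base)
      finally show ?thesis .
    qed
    also have "(\<Sum>p\<in>A \<times> B. P (fst p) (snd p) * R (snd p) powr (- b)) = ZR"
    proof -
      have "(\<Sum>p\<in>A \<times> B. P (fst p) (snd p) * R (snd p) powr (- b))
          = (\<Sum>x\<in>A. \<Sum>y\<in>B. P x y * R y powr (- b))"
        by (simp add: sum.cartesian_product case_prod_unfold)
      also have "\<dots> = (\<Sum>y\<in>B. R y * R y powr (- b))"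
        by (subst sum.swap) (simp add: R_def sum_distrib_right)
      also have "\<dots> = ZR"
        unfolding ZR_def using R0 by (intro sum.cong) (auto simp: powr_mult_base)
      finally show ?thesis .
    qed
    finally show ?thesis .
  qed
  have N: "(\<Sum>p\<in>A \<times> B. N p) = ZQ * ZR"
    unfolding N_def ZQ_def ZR_def
    by (simp add: sum_product sum.cartesian_product case_prod_unfold)
  have "(\<Sum>x\<in>A. \<Sum>y\<in>B. P x y powr (1 - a)) = (\<Sum>p\<in>A \<times> B. P (fst p) (snd p) powr (1 - a))"
    by (simp add: sum.cartesian_product case_prod_unfold)
  also have "\<dots> = (\<Sum>p\<in>A \<times> B. M p powr (1 - a) * N p powr a)"
    by (intro sum.cong eq) auto
  also have "\<dots> \<le> (\<Sum>p\<in>A \<times> B. M p) powr (1 - a) * (\<Sum>p\<in>A \<times> B. N p) powr a"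
    using a assms M0 by (intro Holder_sum2) (auto simp: N_def)
  also have "\<dots> \<le> (ZQ powr (1/2) * ZR powr (1/2)) powr (1 - a) * (ZQ * ZR) powr a"
    unfolding N using half a M0
    by (intro mult_right_mono powr_mono2) (auto intro: sum_nonneg)
  also have "\<dots> = (ZQ * ZR) powr ((1 - a) / 2) * (ZQ * ZR) powr a"
    using nn by (simp add: powr_powr flip: powr_mult)
  also have "\<dots> = (ZQ * ZR) powr ((1 + a) / 2)"
  proof -
    have exp: "(1 - a) / 2 + a = (1 + a) / 2" by (simp add: field_simps)
    show ?thesis by (simp only: powr_add [symmetric] exp)
  qed
  finally show ?thesis unfolding ZQ_def ZR_def Q_def R_def .
qed

section \<open>Fourier analysis on the cube\<close>

text \<open>Expectation over a uniform point of the cube. With points encoded as subsets, fixing the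
  coordinates in \<open>B\<close> to \<open>Y\<close> gives simply
  \<open>X \<mapsto> f (X \<union> Y)\<close>, and characters become symmetric in index and
  point.\<close>

definition avg :: "'a set \<Rightarrow> ('a set \<Rightarrow> real) \<Rightarrow> real" where
  "avg V f = (\<Sum>X\<in>Pow V. f X) / 2 ^ card V"

definition chi :: "'a set \<Rightarrow> 'a set \<Rightarrow> real" where
  "chi S X = (- 1) ^ card (S \<inter> X)"

definition fcoef :: "'a set \<Rightarrow> ('a set \<Rightarrow> real) \<Rightarrow> 'a set \<Rightarrow> real" where
  "fcoef V f S = avg V (\<lambda>X. f X * chi S X)"

definition infl :: "'a set \<Rightarrow> ('a set \<Rightarrow> real) \<Rightarrow> real" where
  "infl V f = (\<Sum>S\<in>Pow V. real (card S) * (fcoef V f S)\<^sup>2)"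

lemma avg_empty [simp]: "avg {} f = f {}"
  by (simp add: avg_def)

lemma avg_cong: "(\<And>X. X \<subseteq> V \<Longrightarrow> f X = g X) \<Longrightarrow> avg V f = avg V g"
  by (simp add: avg_def)

lemma avg_add: "avg V (\<lambda>X. f X + g X) = avg V f + avg V g"
  by (simp add: avg_def sum.distrib add_divide_distrib)

lemma avg_cmult: "avg V (\<lambda>X. c * f X) = c * avg V f"
  by (simp add: avg_def sum_distrib_left)

lemma avg_multc: "avg V (\<lambda>X. f X * c) = avg V f * c"
  using avg_cmult[of V c f] by (simp add: mult.commute)

lemma avg_divide: "avg V (\<lambda>X. f X / c) = avg V f / c"
  by (simp add: avg_def mult.commute flip: sum_divide_distrib)

lemma avg_sum: "avg V (\<lambda>X. \<Sum>i\<in>I. f i X) = (\<Sum>i\<in>I. avg V (f i))"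
  by (simp add: avg_def sum_divide_distrib) (rule sum.swap)

lemma avg_mono: "(\<And>X. X \<subseteq> V \<Longrightarrow> f X \<le> g X) \<Longrightarrow> avg V f \<le> avg V g"
  by (auto simp: avg_def intro!: divide_right_mono sum_mono)

lemma avg_nonneg: "(\<And>X. X \<subseteq> V \<Longrightarrow> 0 \<le> f X) \<Longrightarrow> 0 \<le> avg V f"
  by (auto simp: avg_def intro!: divide_nonneg_nonneg sum_nonneg)

lemma avg_const [simp]: "finite V \<Longrightarrow> avg V (\<lambda>X. c) = c"
  by (simp add: avg_def card_Pow)

lemma abs_avg_le: "\<bar>avg V f\<bar> \<le> avg V (\<lambda>X. \<bar>f X\<bar>)"
  by (simp add: avg_def divide_right_mono sum_abs)

lemma sum_Pow_disjoint_union: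
  assumes "A \<inter> B = {}"
  shows "(\<Sum>Z\<in>Pow (A \<union> B). f Z) = (\<Sum>X\<in>Pow A. \<Sum>Y\<in>Pow B. f (X \<union> Y))"
proof -
  have "(\<Sum>X\<in>Pow A. \<Sum>Y\<in>Pow B. f (X \<union> Y)) = (\<Sum>p\<in>Pow A \<times> Pow B. f (fst p \<union> snd p))"
    by (simp add: sum.cartesian_product case_prod_unfold)
  also have "\<dots> = (\<Sum>Z\<in>Pow (A \<union> B). f Z)"
    by (rule sum.reindex_bij_witness[where i="\<lambda>Z. (Z \<inter> A, Z \<inter> B)" and j="\<lambda>p. fst p \<union> snd p"])
       (use assms in auto)
  finally show ?thesis by simp
qed

lemma avg_split:
  assumes "finite A" "finite B" "A \<inter> B = {}"
  shows "avg (A \<union> B) f = avg B (\<lambda>Y. avg A (\<lambda>X. f (X \<union> Y)))"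
proof -
  have "(\<Sum>Z\<in>Pow (A \<union> B). f Z) = (\<Sum>Y\<in>Pow B. \<Sum>X\<in>Pow A. f (X \<union> Y))"
    using assms by (simp add: sum_Pow_disjoint_union) (rule sum.swap)
  then show ?thesis
    using assms by (simp add: avg_def card_Un_disjoint power_add sum_divide_distrib)
qed

lemma avg_insert:
  assumes "finite V" "v \<notin> V"
  shows "avg (insert v V) f = avg V (\<lambda>X. (f X + f (insert v X)) / 2)"
proof -
  have "avg (V \<union> {v}) f = avg {v} (\<lambda>Y. avg V (\<lambda>X. f (X \<union> Y)))"
    using assms by (intro avg_split) auto
  then show ?thesis
    by (simp add: avg_def [of "{v}"] Pow_insert avg_divide avg_add)
qed

lemma chi_empty [simp]: "chi {} X = 1" "chi S {} = 1"
  by (simp_all add: chi_def)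

lemma chi_commute: "chi S X = chi X S"
  by (simp add: chi_def Int_commute)

lemma chi_Un_Un:
  assumes "T \<subseteq> A" "R \<subseteq> B" "X \<subseteq> A" "Y \<subseteq> B" "finite A" "finite B" "A \<inter> B = {}"
  shows "chi (T \<union> R) (X \<union> Y) = chi T X * chi R Y"
proof -
  have "(T \<union> R) \<inter> (X \<union> Y) = (T \<inter> X) \<union> (R \<inter> Y)" using assms by auto
  moreover have "finite (T \<inter> X)" "finite (R \<inter> Y)" "(T \<inter> X) \<inter> (R \<inter> Y) = {}"
    using assms by (auto dest: finite_subset)
  ultimately show ?thesis
    unfolding chi_def by (simp add: card_Un_disjoint power_add)
qed

text \<open>Elements of \<open>S \<inter> T\<close> are counted twice and do not affect the
  parity.\<close>

lemma chi_sym_diff: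
  assumes "finite X"
  shows "chi S X * chi T X = chi (sym_diff S T) X"
proof -
  have "card (S \<inter> X) + card (T \<inter> X) = card (sym_diff S T \<inter> X) + 2 * card (S \<inter> T \<inter> X)"
  proof -
    have "S \<inter> X = (S - T) \<inter> X \<union> S \<inter> T \<inter> X" "T \<inter> X = (T - S) \<inter> X \<union> S \<inter> T \<inter> X"
      "sym_diff S T \<inter> X = (S - T) \<inter> X \<union> (T - S) \<inter> X" by auto
    then have "card (S \<inter> X) = card ((S - T) \<inter> X) + card (S \<inter> T \<inter> X)"
      "card (T \<inter> X) = card ((T - S) \<inter> X) + card (S \<inter> T \<inter> X)"
      "card (sym_diff S T \<inter> X) = card ((S - T) \<inter> X) + card ((T - S) \<inter> X)"
      using assms by (metis (no_types, lifting) card_Un_disjoint finite_Int Int_Diff Diff_disjoint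
          Int_left_commute Int_assoc Int_commute Int_empty_right inf_bot_left Diff_Int_distrib2)+
    then show ?thesis by simp
  qed
  then show ?thesis
    unfolding chi_def power_add [symmetric] by (simp only: power_add power_mult) simp
qed

lemma avg_chi:
  assumes "finite V" "S \<subseteq> V"
  shows "avg V (chi S) = (if S = {} then 1 else 0)"
proof (cases "S = {}")
  case True
  then show ?thesis using assms by (simp add: avg_def chi_def card_Pow)
next
  case False
  then obtain v where v: "v \<in> S" by auto
  have "avg (insert v (V - {v})) (chi S) = 0"
  proof (subst avg_insert)
    \<comment> \<open>Adding \<open>v\<close> to \<open>X\<close> flips the sign of the character,
      so the two halves of the cube cancel.\<close>
    have "chi S X + chi S (insert v X) = 0" if "X \<subseteq> V - {v}" for X
    proof -
      have "S \<inter> insert v X = insert v (S \<inter> X)" "v \<notin> S \<inter> X" "finite (S \<inter> X)"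
        using v that assms by (auto dest: finite_subset)
      then show ?thesis by (simp add: chi_def)
    qed
    then have "avg (V - {v}) (\<lambda>X. (chi S X + chi S (insert v X)) / 2) = avg (V - {v}) (\<lambda>X. 0)"
      by (intro avg_cong) simp
    then show "avg (V - {v}) (\<lambda>X. (chi S X + chi S (insert v X)) / 2) = 0"
      using assms by simp
  qed (use assms in auto)
  then show ?thesis using v assms False by (simp add: insert_absorb subset_iff)
qed

lemma avg_chi_mult_chi:
  assumes "finite V" "S \<subseteq> V" "T \<subseteq> V"
  shows "avg V (\<lambda>X. chi S X * chi T X) = (if S = T then 1 else 0)"
proof -
  have "avg V (\<lambda>X. chi S X * chi T X) = avg V (chi (sym_diff S T))"
    using assms by (intro avg_cong chi_sym_diff) (auto dest: finite_subset)
  also have "\<dots> = (if S = T then 1 else 0)"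
    using assms by (subst avg_chi) auto
  finally show ?thesis .
qed

lemma avg_chi_expansion_square:
  assumes "finite V" "\<A> \<subseteq> Pow V"
  shows "avg V (\<lambda>X. (\<Sum>S\<in>\<A>. c S * chi S X)\<^sup>2) = (\<Sum>S\<in>\<A>. (c S)\<^sup>2)"
proof -
  have fin: "finite \<A>" using assms by (meson finite_Pow_iff finite_subset)
  have "avg V (\<lambda>X. (\<Sum>S\<in>\<A>. c S * chi S X)\<^sup>2)
      = (\<Sum>S\<in>\<A>. \<Sum>T\<in>\<A>. c S * c T * avg V (\<lambda>X. chi S X * chi T X))"
    by (simp add: power2_eq_square sum_product avg_sum avg_cmult [symmetric] mult_ac)
  also have "\<dots> = (\<Sum>S\<in>\<A>. \<Sum>T\<in>\<A>. if S = T then c S * c T else 0)"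
  proof (intro sum.cong refl)
    fix S T assume "S \<in> \<A>" "T \<in> \<A>"
    then have "S \<subseteq> V" "T \<subseteq> V" using assms by auto
    then show "c S * c T * avg V (\<lambda>X. chi S X * chi T X) = (if S = T then c S * c T else 0)"
      using assms by (simp add: avg_chi_mult_chi)
  qed
  also have "\<dots> = (\<Sum>S\<in>\<A>. (c S)\<^sup>2)"
    using fin by (simp add: sum.delta' power2_eq_square)
  finally show ?thesis .
qed

lemma fourier_inversion:
  assumes "finite V" "X \<subseteq> V"
  shows "f X = (\<Sum>S\<in>Pow V. fcoef V f S * chi S X)"
proof -
  have "(\<Sum>S\<in>Pow V. fcoef V f S * chi S X)
      = avg V (\<lambda>Y. f Y * (\<Sum>S\<in>Pow V. chi S Y * chi S X))"
    by (simp add: fcoef_def sum_distrib_left avg_sum avg_multc [symmetric] mult.assoc)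
  also have "\<dots> = avg V (\<lambda>Y. f Y * (if Y = X then 2 ^ card V else 0))"
  proof (rule avg_cong)
    fix Y assume "Y \<subseteq> V"
    \<comment> \<open>By symmetry of \<open>chi\<close>, the sum over all indices is again an
      average over points, so orthogonality of characters applies with the roles exchanged.\<close>
    then have "(\<Sum>S\<in>Pow V. chi S Y * chi S X) = 2 ^ card V * avg V (\<lambda>S. chi Y S * chi X S)"
      by (simp add: avg_def chi_commute[of _ Y] chi_commute[of _ X])
    then show "f Y * (\<Sum>S\<in>Pow V. chi S Y * chi S X) = f Y * (if Y = X then 2 ^ card V else 0)"
      using assms \<open>Y \<subseteq> V\<close> by (simp add: avg_chi_mult_chi)
  qed
  also have "\<dots> = (\<Sum>Y\<in>Pow V. if Y = X then f Y else 0)"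
    unfolding avg_def sum_divide_distrib by (intro sum.cong) auto
  also have "\<dots> = f X"
    using assms by (simp add: sum.delta')
  finally show ?thesis by simp
qed

lemma parseval:
  assumes "finite V"
  shows "avg V (\<lambda>X. (f X)\<^sup>2) = (\<Sum>S\<in>Pow V. (fcoef V f S)\<^sup>2)"
proof -
  have "avg V (\<lambda>X. (f X)\<^sup>2) = avg V (\<lambda>X. (\<Sum>S\<in>Pow V. fcoef V f S * chi S X)\<^sup>2)"
    using assms by (intro avg_cong) (simp flip: fourier_inversion)
  then show ?thesis using assms by (simp add: avg_chi_expansion_square)
qed

lemma fcoef_Un:
  assumes "finite A" "finite B" "A \<inter> B = {}" "T \<subseteq> A" "R \<subseteq> B"
  shows "fcoef (A \<union> B) f (T \<union> R) = fcoef B (\<lambda>Y. fcoef A (\<lambda>X. f (X \<union> Y)) T) R"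
proof -
  have "fcoef (A \<union> B) f (T \<union> R) = avg B (\<lambda>Y. avg A (\<lambda>X. f (X \<union> Y) * chi (T \<union> R) (X \<union> Y)))"
    unfolding fcoef_def using assms by (intro avg_split)
  also have "\<dots> = avg B (\<lambda>Y. avg A (\<lambda>X. f (X \<union> Y) * chi T X * chi R Y))"
    using assms by (intro avg_cong) (simp add: chi_Un_Un[of T A R B])
  also have "\<dots> = fcoef B (\<lambda>Y. fcoef A (\<lambda>X. f (X \<union> Y)) T) R"
    by (simp add: fcoef_def avg_multc)
  finally show ?thesis .
qed

lemma avg_fcoef_restrict_square:
  assumes "finite A" "finite B" "A \<inter> B = {}" "T \<subseteq> A"
  shows "avg B (\<lambda>Y. (fcoef A (\<lambda>X. f (X \<union> Y)) T)\<^sup>2) = (\<Sum>R\<in>Pow B. (fcoef (A \<union> B) f (T \<union> R))\<^sup>2)"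
  using assms by (simp add: parseval fcoef_Un)

lemma infl_nonneg: "0 \<le> infl V f"
  by (simp add: infl_def sum_nonneg)

text \<open>Restricting discards the directions in \<open>B\<close>: a coefficient at
  \<open>T \<union> R\<close> is counted \<open>card T\<close> times instead of
  \<open>card (T \<union> R)\<close> times.\<close>

lemma avg_infl_restrict_le:
  assumes "finite A" "finite B" "A \<inter> B = {}"
  shows "avg B (\<lambda>Y. infl A (\<lambda>X. f (X \<union> Y))) \<le> infl (A \<union> B) f"
proof -
  have "avg B (\<lambda>Y. infl A (\<lambda>X. f (X \<union> Y)))
      = (\<Sum>T\<in>Pow A. real (card T) * avg B (\<lambda>Y. (fcoef A (\<lambda>X. f (X \<union> Y)) T)\<^sup>2))"
    by (simp add: infl_def avg_sum avg_cmult)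
  also have "\<dots> = (\<Sum>T\<in>Pow A. \<Sum>R\<in>Pow B. real (card T) * (fcoef (A \<union> B) f (T \<union> R))\<^sup>2)"
    using assms by (intro sum.cong refl) (simp add: avg_fcoef_restrict_square sum_distrib_left)
  also have "\<dots> \<le> (\<Sum>T\<in>Pow A. \<Sum>R\<in>Pow B. real (card (T \<union> R)) * (fcoef (A \<union> B) f (T \<union> R))\<^sup>2)"
    using assms
    by (intro sum_mono mult_right_mono) (auto intro!: card_mono dest: finite_subset)
  also have "\<dots> = infl (A \<union> B) f"
    unfolding infl_def using assms by (simp add: sum_Pow_disjoint_union)
  finally show ?thesis .
qed

text \<open>The coefficient at \<open>{i}\<close> is the mean of the discrete derivative
  \<open>D\<close> in direction \<open>i\<close>. As \<open>D\<close> takes only the values 0 and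
  +-1/2, its absolute value equals twice its square, and the mean square is the spectral weight of
  the sets containing \<open>i\<close>.\<close>

lemma sum_abs_fcoef_singleton_le:
  assumes "finite V" and f: "f ` Pow V \<subseteq> {0, 1}"
  shows "(\<Sum>i\<in>V. \<bar>fcoef V f {i}\<bar>) \<le> 2 * infl V f"
proof -
  have one: "\<bar>fcoef V f {i}\<bar> \<le> 2 * (\<Sum>S\<in>Pow V. if i \<in> S then (fcoef V f S)\<^sup>2 else 0)" if "i \<in> V" for i
  proof -
    define B where "B = V - {i}"
    have B: "finite B" "{i} \<inter> B = {}" "{i} \<union> B = V" using assms that by (auto simp: B_def)
    define D where "D Y = fcoef {i} (\<lambda>X. f (X \<union> Y)) {i}" for Y
    have D: "\<bar>D Y\<bar> = 2 * (D Y)\<^sup>2" if "Y \<subseteq> B" for Y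
    proof -
      have "D Y = (f Y - f (insert i Y)) / 2"
        unfolding D_def fcoef_def by (simp add: avg_def Pow_insert chi_def)
      moreover have "f Y \<in> {0, 1}" "f (insert i Y) \<in> {0, 1}"
        using f that B by (simp_all only: image_subset_iff) blast+
      ultimately have "D Y \<in> {0, 1/2, -1/2}" by auto
      then show ?thesis by (auto simp: power2_eq_square)
    qed
    have "fcoef V f {i} = avg B D"
      using fcoef_Un[of "{i}" B "{i}" "{}" f] B by (simp add: D_def [abs_def] fcoef_def[of B])
    then have "\<bar>fcoef V f {i}\<bar> \<le> avg B (\<lambda>Y. \<bar>D Y\<bar>)" by (simp add: abs_avg_le)
    also have "\<dots> = avg B (\<lambda>Y. 2 * (D Y)\<^sup>2)" by (intro avg_cong D)
    also have "\<dots> = 2 * (\<Sum>R\<in>Pow B. (fcoef V f ({i} \<union> R))\<^sup>2)"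
      using avg_fcoef_restrict_square[of "{i}" B "{i}" f] B by (simp add: avg_cmult D_def)
    also have "(\<Sum>R\<in>Pow B. (fcoef V f ({i} \<union> R))\<^sup>2) = (\<Sum>S\<in>Pow V. if i \<in> S then (fcoef V f S)\<^sup>2 else 0)"
    proof -
      have "(\<Sum>S\<in>Pow V. if i \<in> S then (fcoef V f S)\<^sup>2 else 0)
          = (\<Sum>X\<in>{{}, {i}}. \<Sum>R\<in>Pow B. if i \<in> X \<union> R then (fcoef V f (X \<union> R))\<^sup>2 else 0)"
        using sum_Pow_disjoint_union[OF B(2), of "\<lambda>S. if i \<in> S then (fcoef V f S)\<^sup>2 else 0"]
        by (simp only: B(3) Pow_insert Pow_empty image_insert image_empty) (simp add: insert_commute)
      moreover have "(\<Sum>R\<in>Pow B. if i \<in> {} \<union> R then (fcoef V f ({} \<union> R))\<^sup>2 else 0) = 0"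
        using B by (intro sum.neutral) auto
      ultimately show ?thesis
        by simp
    qed
    finally show ?thesis .
  qed
  have "(\<Sum>i\<in>V. \<bar>fcoef V f {i}\<bar>) \<le> 2 * (\<Sum>i\<in>V. \<Sum>S\<in>Pow V. if i \<in> S then (fcoef V f S)\<^sup>2 else 0)"
    by (subst sum_distrib_left) (intro sum_mono one)
  also have "(\<Sum>i\<in>V. \<Sum>S\<in>Pow V. if i \<in> S then (fcoef V f S)\<^sup>2 else 0)
      = (\<Sum>S\<in>Pow V. \<Sum>i\<in>V. if i \<in> S then (fcoef V f S)\<^sup>2 else 0)"
    by (rule sum.swap)
  also have "\<dots> = infl V f"
    unfolding infl_def
  proof (intro sum.cong refl)
    fix S assume "S \<in> Pow V"
    then have "V \<inter> S = S" by auto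
    then show "(\<Sum>i\<in>V. if i \<in> S then (fcoef V f S)\<^sup>2 else 0) = real (card S) * (fcoef V f S)\<^sup>2"
      using assms by (simp flip: sum.inter_restrict)
  qed
  finally show ?thesis .
qed

section \<open>Hypercontractivity\<close>

lemma avg_Cauchy_Schwarz:
  "(avg V (\<lambda>X. f X * g X))\<^sup>2 \<le> avg V (\<lambda>X. (f X)\<^sup>2) * avg V (\<lambda>X. (g X)\<^sup>2)"
proof -
  have "(\<Sum>X\<in>Pow V. f X * g X)\<^sup>2 \<le> (\<Sum>X\<in>Pow V. (f X)\<^sup>2) * (\<Sum>X\<in>Pow V. (g X)\<^sup>2)"
    by (rule Cauchy_Schwarz_ineq_sum)
  then show ?thesis
    by (simp add: avg_def power_divide divide_right_mono flip: power_mult_distrib power2_eq_square)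
qed

text \<open>Bonami's inequality between the fourth and the second moment of a polynomial of degree
  at most \<open>k\<close>. The induction removes one variable \<open>v\<close> and writes the
  polynomial as \<open>p\<close> plus the sign of \<open>v\<close> times \<open>q\<close>; averaging
  over that sign kills the odd powers of \<open>q\<close>.\<close>

lemma bonami:
  assumes "finite V" "\<A> \<subseteq> {S. S \<subseteq> V \<and> card S \<le> k}"
  shows "avg V (\<lambda>X. (\<Sum>S\<in>\<A>. c S * chi S X) ^ 4) \<le> 9 ^ k * (\<Sum>S\<in>\<A>. (c S)\<^sup>2)\<^sup>2"
  using assms
proof (induction V arbitrary: \<A> k c rule: finite_induct)
  case empty
  then have "\<A> = {} \<or> \<A> = {{}}" by auto
  then show ?case
  proof
    assume "\<A> = {{}}"
    moreover have "1 * c {} ^ 4 \<le> 9 ^ k * c {} ^ 4" by (intro mult_right_mono) auto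
    ultimately show ?thesis by (simp flip: power_mult)
  qed simp
next
  case (insert v V)
  define \<A>0 where "\<A>0 = {S \<in> \<A>. v \<notin> S}"
  define \<A>1 where "\<A>1 = (\<lambda>S. S - {v}) ` {S \<in> \<A>. v \<in> S}"
  have fin: "finite \<A>"
    using insert by (intro finite_subset[of \<A> "Pow (insert v V)"]) auto
  define p where "p X = (\<Sum>S\<in>\<A>0. c S * chi S X)" for X
  define q where "q X = (\<Sum>S\<in>\<A>1. c (insert v S) * chi S X)" for X
  define a where "a = (\<Sum>S\<in>\<A>0. (c S)\<^sup>2)"
  define b where "b = (\<Sum>S\<in>\<A>1. (c (insert v S))\<^sup>2)"
  have ab: "a \<ge> 0" "b \<ge> 0" by (auto simp: a_def b_def sum_nonneg)
  have split: "(\<Sum>S\<in>\<A>. F S) = (\<Sum>S\<in>\<A>0. F S) + (\<Sum>S\<in>\<A>1. F (insert v S))" for F :: "_ \<Rightarrow> real"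
  proof -
    have "(\<Sum>S\<in>\<A>. F S) = (\<Sum>S\<in>\<A>0. F S) + (\<Sum>S\<in>{S \<in> \<A>. v \<in> S}. F S)"
      unfolding \<A>0_def using fin
      by (subst sum.union_disjoint [symmetric]) (auto intro!: sum.cong)
    also have "(\<Sum>S\<in>{S \<in> \<A>. v \<in> S}. F S) = (\<Sum>S\<in>\<A>1. F (insert v S))"
      by (rule sum.reindex_bij_witness[where i="insert v" and j="\<lambda>S. S - {v}"])
         (auto simp: \<A>1_def insert_absorb)
    finally show ?thesis .
  qed
  have A0: "\<A>0 \<subseteq> {S. S \<subseteq> V \<and> card S \<le> k}"
    using insert.prems by (auto simp: \<A>0_def)
  have chi_v: "chi S (insert v X) = chi S X" "chi (insert v S) X = chi S X"
    "chi (insert v S) (insert v X) = - chi S X" if "S \<subseteq> V" "X \<subseteq> V" for S X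
  proof -
    have "S \<inter> insert v X = S \<inter> X" "insert v S \<inter> X = S \<inter> X"
      "insert v S \<inter> insert v X = insert v (S \<inter> X)" "v \<notin> S \<inter> X" "finite (S \<inter> X)"
      using that insert.hyps by (auto dest: finite_subset)
    then show "chi S (insert v X) = chi S X" "chi (insert v S) X = chi S X"
      "chi (insert v S) (insert v X) = - chi S X"
      by (simp_all add: chi_def)
  qed
  have A1: "S \<subseteq> V" "card S < k" if S: "S \<in> \<A>1" for S
  proof -
    obtain S' where S': "S' \<in> \<A>" "v \<in> S'" "S = S' - {v}" using S unfolding \<A>1_def by blast
    then have "S' \<subseteq> insert v V" "card S' \<le> k" using insert.prems by auto
    moreover from this have "finite S'" using insert.hyps by (auto dest: finite_subset)
    ultimately show "S \<subseteq> V" "card S < k"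
      using S' by (auto simp: card_Diff_singleton_if) (metis card_gt_0_iff diff_Suc_less
          empty_iff less_le_trans)
  qed
  have exp: "(\<Sum>S\<in>\<A>. c S * chi S X) = p X + q X" "(\<Sum>S\<in>\<A>. c S * chi S (insert v X)) = p X - q X"
    if "X \<subseteq> V" for X
  proof -
    show "(\<Sum>S\<in>\<A>. c S * chi S X) = p X + q X"
      unfolding split p_def q_def using that A1 by (simp add: chi_v)
    have "(\<Sum>S\<in>\<A>0. c S * chi S (insert v X)) = p X"
      unfolding p_def using that A0 by (intro sum.cong) (auto simp: chi_v)
    moreover have "(\<Sum>S\<in>\<A>1. c (insert v S) * chi (insert v S) (insert v X)) = - q X"
      unfolding q_def using that A1 by (simp add: chi_v sum_negf)
    ultimately show "(\<Sum>S\<in>\<A>. c S * chi S (insert v X)) = p X - q X"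
      unfolding split by simp
  qed
  have P4: "avg V (\<lambda>X. p X ^ 4) \<le> 9 ^ k * a\<^sup>2"
    unfolding p_def a_def by (rule insert.IH[OF A0])
  \<comment> \<open>The polynomial \<open>q\<close> has degree at most \<open>k - 1\<close>, which
    gains a factor 9.\<close>
  have Q4: "9 * avg V (\<lambda>X. q X ^ 4) \<le> 9 ^ k * b\<^sup>2"
  proof (cases k)
    case 0
    then have "\<A>1 = {}" using A1 by auto
    then show ?thesis using insert.hyps by (simp add: q_def b_def)
  next
    case (Suc l)
    have "avg V (\<lambda>X. q X ^ 4) \<le> 9 ^ l * b\<^sup>2"
      unfolding q_def b_def using A1 Suc by (intro insert.IH) (auto simp: less_Suc_eq_le)
    then show ?thesis using Suc by simp
  qed
  \<comment> \<open>The square root of that gain is 3, so the middle term with binomial coefficient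
    6 contributes exactly the \<open>2 * a * b\<close> of \<open>(a + b)^2\<close>.\<close>
  have PQ: "avg V (\<lambda>X. (p X)\<^sup>2 * (q X)\<^sup>2) \<le> 9 ^ k * (a * b) / 3"
  proof (rule power2_le_imp_le)
    have "(avg V (\<lambda>X. (p X)\<^sup>2 * (q X)\<^sup>2))\<^sup>2 \<le> avg V (\<lambda>X. p X ^ 4) * avg V (\<lambda>X. q X ^ 4)"
      using avg_Cauchy_Schwarz[of V "\<lambda>X. (p X)\<^sup>2" "\<lambda>X. (q X)\<^sup>2"] by (simp flip: power_mult)
    also have "\<dots> \<le> (9 ^ k * a\<^sup>2) * (9 ^ k * b\<^sup>2 / 9)"
      using P4 Q4 by (intro mult_mono) (auto intro!: avg_nonneg)
    also have "\<dots> = (9 ^ k * (a * b) / 3)\<^sup>2"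
      by (simp add: power2_eq_square)
    finally show "(avg V (\<lambda>X. (p X)\<^sup>2 * (q X)\<^sup>2))\<^sup>2 \<le> (9 ^ k * (a * b) / 3)\<^sup>2" .
  qed (use ab in simp)
  have "avg (insert v V) (\<lambda>X. (\<Sum>S\<in>\<A>. c S * chi S X) ^ 4)
      = avg V (\<lambda>X. ((p X + q X) ^ 4 + (p X - q X) ^ 4) / 2)"
    using insert.hyps by (subst avg_insert) (auto simp: exp intro!: avg_cong)
  also have "\<dots> = avg V (\<lambda>X. p X ^ 4 + 6 * ((p X)\<^sup>2 * (q X)\<^sup>2) + q X ^ 4)"
    by (intro avg_cong) (simp add: power4_eq_xxxx power2_eq_square algebra_simps)
  also have "\<dots> = avg V (\<lambda>X. p X ^ 4) + 6 * avg V (\<lambda>X. (p X)\<^sup>2 * (q X)\<^sup>2) + avg V (\<lambda>X. q X ^ 4)"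
    by (simp add: avg_add avg_cmult)
  also have "\<dots> \<le> 9 ^ k * a\<^sup>2 + 6 * (9 ^ k * (a * b) / 3) + 9 ^ k * b\<^sup>2"
  proof -
    have "avg V (\<lambda>X. q X ^ 4) \<ge> 0" by (intro avg_nonneg) auto
    then show ?thesis using P4 Q4 PQ by linarith
  qed
  also have "\<dots> = 9 ^ k * (a + b)\<^sup>2"
    by (simp add: power2_eq_square algebra_simps)
  also have "a + b = (\<Sum>S\<in>\<A>. (c S)\<^sup>2)"
    unfolding split a_def b_def ..
  finally show ?case .
qed

text \<open>Since \<open>Q\<close> is the squared norm of the projection \<open>h\<close> of \<open>g\<close> to the levels in \<open>\<A>\<close>, it equals
  \<open>\<langle>h, g\<rangle>\<close>; Hoelder's inequality bounds this by the norms \<open>\<parallel>h\<parallel>\<^sub>2\<close>, \<open>\<parallel>h\<parallel>\<^sub>4\<close> and \<open>\<parallel>g\<parallel>\<^sub>q\<close> with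
  \<open>q = 2 - 2 * b\<close>, and the exponents are chosen so that \<open>h\<close> enters with total weight \<open>\<parallel>h\<parallel>\<^sub>2\<close>.\<close>

lemma low_level_weight_powr_le:
  assumes "finite V" and \<A>: "\<A> \<subseteq> {S. S \<subseteq> V \<and> card S \<le> k}" and b: "0 < b" "b \<le> 1/3"
  shows "(\<Sum>S\<in>\<A>. (fcoef V g S)\<^sup>2) powr (1 - b) \<le> 9 powr (real k * b) * avg V (\<lambda>X. \<bar>g X\<bar> powr (2 - 2 * b))"
proof -
  define Q where "Q = (\<Sum>S\<in>\<A>. (fcoef V g S)\<^sup>2)"
  define h where "h X = (\<Sum>S\<in>\<A>. fcoef V g S * chi S X)" for X
  define G where "G = avg V (\<lambda>X. \<bar>g X\<bar> powr (2 - 2 * b))"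
  have G: "G \<ge> 0" by (auto simp: G_def intro: avg_nonneg)
  have Q0: "Q \<ge> 0" by (simp add: Q_def sum_nonneg)
  show ?thesis
  proof (cases "Q = 0")
    case True
    then show ?thesis using G b unfolding Q_def G_def by simp
  next
    case False
    with Q0 have Q: "Q > 0" by simp
    \<comment> \<open>The unique solution of \<open>\<alpha> + \<beta> + \<gamma> = 1\<close>,
      \<open>2 * \<alpha> + 4 * \<beta> = 1\<close> and \<open>(2 - 2 * b) * \<gamma> = 1\<close>;
      the condition \<open>b \<le> 1/3\<close> makes \<open>\<alpha>\<close> nonnegative.\<close>
    define \<alpha> \<beta> \<gamma> where "\<alpha> = (1 - 3 * b) / (2 - 2 * b)" "\<beta> = b / (2 - 2 * b)" "\<gamma> = 1 / (2 - 2 * b)"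
    note defs = this
    have abc: "\<alpha> \<ge> 0" "\<beta> > 0" "\<gamma> > 0" "\<alpha> + \<beta> + \<gamma> = 1" "2 * \<alpha> + 4 * \<beta> = 1" "\<alpha> + 2 * \<beta> = 1/2"
      "(2 - 2 * b) * \<gamma> = 1" "\<beta> * (2 - 2 * b) = b"
      using b unfolding defs by (auto simp: divide_simps)
    define M where "M = (2::real) ^ card V"
    have M: "M > 0" by (simp add: M_def)
    have "Q = avg V (\<lambda>X. g X * h X)"
    proof -
      have "avg V (\<lambda>X. g X * h X) = (\<Sum>S\<in>\<A>. avg V (\<lambda>X. fcoef V g S * (g X * chi S X)))"
        by (simp add: h_def sum_distrib_left avg_sum mult_ac)
      also have "\<dots> = Q"
        unfolding avg_cmult fcoef_def [symmetric] by (simp add: Q_def power2_eq_square)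
      finally show ?thesis by simp
    qed
    also have "\<dots> \<le> avg V (\<lambda>X. ((h X)\<^sup>2) powr \<alpha> * (h X ^ 4) powr \<beta> * (\<bar>g X\<bar> powr (2 - 2 * b)) powr \<gamma>)"
    proof (rule avg_mono)
      fix X
      have "((h X)\<^sup>2) powr \<alpha> * (h X ^ 4) powr \<beta> = \<bar>h X\<bar>"
      proof (cases "h X = 0")
        case False
        have "(h X)\<^sup>2 = \<bar>h X\<bar> powr 2" "h X ^ 4 = \<bar>h X\<bar> powr 4"
          using False by (simp_all add: powr_numeral power_even_abs_numeral)
        then have "((h X)\<^sup>2) powr \<alpha> * (h X ^ 4) powr \<beta> = \<bar>h X\<bar> powr (2 * \<alpha> + 4 * \<beta>)"
          by (simp only: powr_powr powr_add)
        then show ?thesis using abc by simp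
      qed auto
      moreover have "(\<bar>g X\<bar> powr (2 - 2 * b)) powr \<gamma> = \<bar>g X\<bar>"
        using abc by (simp add: powr_powr)
      ultimately show "g X * h X \<le> ((h X)\<^sup>2) powr \<alpha> * (h X ^ 4) powr \<beta> * (\<bar>g X\<bar> powr (2 - 2 * b)) powr \<gamma>"
        by (metis abs_ge_self abs_mult mult.commute)
    qed
    also have "\<dots> \<le> avg V (\<lambda>X. (h X)\<^sup>2) powr \<alpha> * avg V (\<lambda>X. h X ^ 4) powr \<beta> * G powr \<gamma>"
    proof -
      have "(\<Sum>X\<in>Pow V. ((h X)\<^sup>2) powr \<alpha> * (h X ^ 4) powr \<beta> * (\<bar>g X\<bar> powr (2 - 2 * b)) powr \<gamma>)
         \<le> (\<Sum>X\<in>Pow V. (h X)\<^sup>2) powr \<alpha> * (\<Sum>X\<in>Pow V. h X ^ 4) powr \<beta>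
            * (\<Sum>X\<in>Pow V. \<bar>g X\<bar> powr (2 - 2 * b)) powr \<gamma>"
        using abc assms by (intro Holder_sum3) auto
      \<comment> \<open>Since the exponents add up to 1, the normalising factors match and Hoelder
        for sums becomes Hoelder for averages.\<close>
      moreover have "M = M powr \<alpha> * M powr \<beta> * M powr \<gamma>"
        using abc M by (simp flip: powr_add)
      ultimately show ?thesis
        unfolding avg_def G_def M_def [symmetric] using M
        by (simp add: powr_divide sum_nonneg divide_right_mono)
    qed
    also have "\<dots> \<le> Q powr \<alpha> * (9 ^ k * Q\<^sup>2) powr \<beta> * G powr \<gamma>"
    proof -
      have "avg V (\<lambda>X. (h X)\<^sup>2) = Q"
        unfolding h_def Q_def using assms by (intro avg_chi_expansion_square) auto
      moreover have "avg V (\<lambda>X. h X ^ 4) \<le> 9 ^ k * Q\<^sup>2"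
        unfolding h_def Q_def using assms by (intro bonami)
      ultimately show ?thesis
        using abc G by (intro mult_mono powr_mono2) (auto intro: avg_nonneg)
    qed
    also have "\<dots> = Q powr (1/2) * (9 powr (real k * \<beta>) * G powr \<gamma>)"
    proof -
      have "(9 ^ k * Q\<^sup>2) powr \<beta> = 9 powr (real k * \<beta>) * Q powr (2 * \<beta>)"
        using Q by (simp add: powr_mult powr_powr flip: powr_numeral powr_realpow)
      moreover have "Q powr \<alpha> * Q powr (2 * \<beta>) = Q powr (1/2)"
        by (simp only: powr_add [symmetric] abc(6))
      ultimately show ?thesis by (simp add: mult_ac)
    qed
    finally have "Q \<le> Q powr (1/2) * (9 powr (real k * \<beta>) * G powr \<gamma>)" .
    moreover have "Q = Q powr (1/2) * Q powr (1/2)" using Q by (simp flip: powr_add)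
    ultimately have "Q powr (1/2) \<le> 9 powr (real k * \<beta>) * G powr \<gamma>"
      using Q by (metis mult_le_cancel_left_pos powr_gt_zero less_irrefl)
    \<comment> \<open>The power \<open>2 - 2 * b\<close> turns \<open>G powr \<gamma>\<close> back
      into \<open>G\<close> and \<open>\<beta>\<close> into \<open>b\<close>.\<close>
    then have "(Q powr (1/2)) powr (2 - 2 * b) \<le> (9 powr (real k * \<beta>) * G powr \<gamma>) powr (2 - 2 * b)"
      using b by (intro powr_mono2) auto
    moreover have "(Q powr (1/2)) powr (2 - 2 * b) = Q powr (1 - b)"
      by (simp add: powr_powr diff_divide_distrib)
    moreover have "(9 powr (real k * \<beta>) * G powr \<gamma>) powr (2 - 2 * b) = 9 powr (real k * b) * G"
      using abc G by (simp add: powr_mult powr_powr mult.assoc mult.commute[of \<gamma>])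
    ultimately show ?thesis unfolding Q_def G_def by simp
  qed
qed

section \<open>Doubling the level\<close>

text \<open>Coordinates outside \<open>S\<close> average out. This passes from random partitions of
  \<open>V\<close> to random partitions of a single set.\<close>

lemma avg_inter:
  assumes "finite V" "S \<subseteq> V"
  shows "avg V (\<lambda>A. g (S \<inter> A)) = avg S g"
proof -
  have "avg (S \<union> (V - S)) (\<lambda>A. g (S \<inter> A)) = avg (V - S) (\<lambda>Y. avg S (\<lambda>X. g (S \<inter> (X \<union> Y))))"
    using assms by (intro avg_split) (auto dest: finite_subset)
  also have "\<dots> = avg (V - S) (\<lambda>Y. avg S g)"
  proof (intro avg_cong)
    fix X Y assume "X \<subseteq> S" "Y \<subseteq> V - S"
    then have "S \<inter> (X \<union> Y) = X" by auto
    then show "g (S \<inter> (X \<union> Y)) = g X" by simp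
  qed
  finally show ?thesis using assms by (simp add: Un_absorb1)
qed

text \<open>This is the variance of a sum of \<open>card S\<close> independent random signs; each
  new element adds 1.\<close>

lemma avg_card_deviation_square:
  assumes "finite S"
  shows "avg S (\<lambda>X. (real (card S) - 2 * real (card X))\<^sup>2) = real (card S)"
  using assms
proof (induction S rule: finite_induct)
  case (insert v S)
  have "avg (insert v S) (\<lambda>X. (real (card (insert v S)) - 2 * real (card X))\<^sup>2)
      = avg S (\<lambda>X. (real (card S) - 2 * real (card X))\<^sup>2 + 1)"
    unfolding avg_insert[OF insert.hyps]
  proof (rule avg_cong)
    fix X assume "X \<subseteq> S"
    then have "finite X" "v \<notin> X" using insert.hyps by (auto dest: finite_subset)
    then show "((real (card (insert v S)) - 2 * real (card X))\<^sup>2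
          + (real (card (insert v S)) - 2 * real (card (insert v X)))\<^sup>2) / 2
        = (real (card S) - 2 * real (card X))\<^sup>2 + 1"
      using insert.hyps by (simp add: power2_eq_square field_simps)
  qed
  also have "\<dots> = real (card (insert v S))"
    using insert by (simp add: avg_add)
  finally show ?case .
qed simp

definition splits :: "nat \<Rightarrow> 'a set \<Rightarrow> 'a set \<Rightarrow> bool" where
  "splits k S A \<longleftrightarrow> card (S \<inter> A) \<in> {1..k} \<and> card (S - A) \<in> {1..k}"

text \<open>One part is empty with probability at most 1/2. If \<open>k' \<le> k + 1\<close>, two
  nonempty parts automatically have size at most \<open>k\<close>. Otherwise an oversized part means
  a deviation of at least \<open>2 * k - k'\<close>, hence of at least twice the standard deviation,
  which by Chebyshev has probability at most 1/4.\<close>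

lemma avg_splits_ge:
  fixes S :: "'a set"
  assumes "finite S" and s: "2 \<le> card S" "card S \<le> k'"
    and k: "k' \<le> k + 1 \<or> k' < 2 * k \<and> 4 * k' \<le> (2 * k - k')\<^sup>2"
  shows "1/4 \<le> avg S (\<lambda>X. of_bool (splits k S X))"
proof -
  define s where "s = card S"
  have sub: "card (S - X) = s - card X" "card X \<le> s" "S \<inter> X = X" if "X \<subseteq> S" for X
    using that assms(1) by (auto simp: s_def card_Diff_subset finite_subset card_mono)
  define bad where "bad X = (of_bool (X = {}) + of_bool (X = S) :: real)" for X
  \<comment> \<open>Normalised so that its mean is 1/4 and an oversized part forces it to be at
    least 1; subtracting \<open>bad\<close> and \<open>dev\<close> from 1 thus gives a lower bound
    for the indicator of a good split.\<close>
  define dev where "dev X = (real s - 2 * real (card X))\<^sup>2 / (4 * real s)" for X :: "'a set"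
  have spos: "s \<ge> 2" using s by (simp add: s_def)
  have bad: "avg S bad \<le> 1/2"
  proof -
    have "(\<Sum>X\<in>Pow S. of_bool (X = {}) :: real) = 1" "(\<Sum>X\<in>Pow S. of_bool (X = S) :: real) = 1"
      using assms(1) by (simp_all add: of_bool_def sum.delta)
    then have "avg S bad = 2 / 2 ^ s"
      by (simp add: avg_def bad_def sum.distrib s_def)
    also have "\<dots> \<le> 2 / 2 ^ 2" using spos by (intro divide_left_mono power_increasing) auto
    finally show ?thesis by simp
  qed
  have dev: "avg S dev = 1/4"
    using avg_card_deviation_square[OF assms(1)] spos unfolding dev_def avg_divide s_def by simp
  have "1/4 \<le> avg S (\<lambda>X. 1 - bad X - dev X)"
  proof -
    have "avg S (\<lambda>X. 1 - bad X - dev X) = avg S (\<lambda>X. 1 + (-1) * bad X + (-1) * dev X)"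
      by (intro avg_cong) simp
    also have "\<dots> = 1 - avg S bad - avg S dev"
      using assms(1) by (simp only: avg_add avg_cmult avg_const)
    finally show ?thesis using bad dev by simp
  qed
  also have "\<dots> \<le> avg S (\<lambda>X. of_bool (splits k S X))"
  proof (rule avg_mono)
    fix X assume X: "X \<subseteq> S"
    have dev0: "dev X \<ge> 0" "bad X \<ge> 0" by (auto simp: dev_def bad_def)
    show "1 - bad X - dev X \<le> of_bool (splits k S X)"
    proof (cases "X = {} \<or> X = S \<or> splits k S X")
      case True
      then show ?thesis using dev0 by (auto simp: bad_def)
    next
      case False
      then have ne: "1 \<le> card X" "1 \<le> s - card X"
        using X assms(1) psubset_card_mono[of S X] by (auto simp: s_def Suc_le_eq card_gt_0_iff finite_subset)
      with False X have big: "card X > k \<or> s - card X > k"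
        by (auto simp: splits_def sub)
      have "dev X \<ge> 1"
      proof -
        have "\<not> k' \<le> k + 1" using big ne s by (auto simp: s_def)
        then have k2: "k' < 2 * k" "4 * k' \<le> (2 * k - k')\<^sup>2" using k by auto
        have "real (2 * k - k') \<le> \<bar>real s - 2 * real (card X)\<bar>"
          using big k2 s sub[OF X] by (auto simp: s_def of_nat_diff)
        then have "(real (2 * k - k'))\<^sup>2 \<le> \<bar>real s - 2 * real (card X)\<bar>\<^sup>2"
          by (intro power_mono) auto
        moreover have "real (4 * k') \<le> real ((2 * k - k')\<^sup>2)"
          using k2(2) by (rule of_nat_mono)
        moreover have "4 * real s \<le> real (4 * k')" using s by (simp add: s_def)
        ultimately have "4 * real s \<le> (real s - 2 * real (card X))\<^sup>2" by simp
        then show ?thesis using spos by (simp add: dev_def)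
      qed
      then show ?thesis using dev0 by simp
    qed
  qed
  finally show ?thesis .
qed

text \<open>Averaging argument: a uniformly random \<open>A\<close> splits each set of
  \<open>\<S>\<close> with probability at least 1/4, so some \<open>A\<close> captures a quarter of
  the total.\<close>

lemma exists_good_split:
  fixes \<phi> :: "'a set \<Rightarrow> real"
  assumes "finite V" and \<phi>: "\<And>S. 0 \<le> \<phi> S"
    and \<S>: "\<And>S. S \<in> \<S> \<Longrightarrow> S \<subseteq> V \<and> 2 \<le> card S \<and> card S \<le> k'"
    and k: "k' \<le> k + 1 \<or> k' < 2 * k \<and> 4 * k' \<le> (2 * k - k')\<^sup>2"
  shows "\<exists>A\<subseteq>V. (\<Sum>S\<in>\<S>. \<phi> S) \<le> 4 * (\<Sum>S\<in>{S \<in> Pow V. splits k S A}. \<phi> S)"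
proof (rule ccontr)
  assume neg: "\<not> ?thesis"
  define W where "W = (\<Sum>S\<in>\<S>. \<phi> S)"
  have sub: "\<S> \<subseteq> Pow V" using \<S> by auto
  then have fin: "finite \<S>" using assms(1) by (meson finite_Pow_iff finite_subset)
  have lt: "4 * (\<Sum>S\<in>\<S>. \<phi> S * of_bool (splits k S A)) < W" if "A \<subseteq> V" for A
  proof -
    have "(\<Sum>S\<in>\<S>. \<phi> S * of_bool (splits k S A)) = (\<Sum>S\<in>{S \<in> \<S>. splits k S A}. \<phi> S)"
      using fin by (simp add: of_bool_def if_distrib sum.inter_filter cong: if_cong)
    also have "\<dots> \<le> (\<Sum>S\<in>{S \<in> Pow V. splits k S A}. \<phi> S)"
      using assms(1) sub \<phi> by (intro sum_mono2) auto
    finally have "4 * (\<Sum>S\<in>\<S>. \<phi> S * of_bool (splits k S A)) \<le> 4 * (\<Sum>S\<in>{S \<in> Pow V. splits k S A}. \<phi> S)"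
      by simp
    also have "4 * (\<Sum>S\<in>{S \<in> Pow V. splits k S A}. \<phi> S) < W"
      using neg that unfolding W_def not_le [symmetric] by blast
    finally show ?thesis .
  qed
  have "W \<le> 4 * avg V (\<lambda>A. \<Sum>S\<in>\<S>. \<phi> S * of_bool (splits k S A))"
  proof -
    have "avg V (\<lambda>A. \<Sum>S\<in>\<S>. \<phi> S * of_bool (splits k S A))
        = (\<Sum>S\<in>\<S>. \<phi> S * avg V (\<lambda>A. of_bool (splits k S A)))"
      by (simp add: avg_sum avg_cmult)
    also have "\<dots> \<ge> (\<Sum>S\<in>\<S>. \<phi> S * (1/4))"
    proof (intro sum_mono mult_left_mono \<phi>)
      fix S assume "S \<in> \<S>"
      with \<S> have S: "S \<subseteq> V" "2 \<le> card S" "card S \<le> k'" by auto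
      have "splits k S A \<longleftrightarrow> splits k S (S \<inter> A)" for A
        unfolding splits_def by (simp add: Diff_Int Int_absorb Int_assoc [symmetric])
      then have "avg V (\<lambda>A. of_bool (splits k S A)) = avg S (\<lambda>X. of_bool (splits k S X))"
        using avg_inter[OF assms(1) S(1), of "\<lambda>X. of_bool (splits k S X)"] by simp
      then show "1/4 \<le> avg V (\<lambda>A. of_bool (splits k S A))"
        using avg_splits_ge[OF _ S(2,3) k] S assms(1) by (auto dest: finite_subset)
    qed
    finally show ?thesis by (simp add: W_def flip: sum_divide_distrib)
  qed
  moreover have "4 * avg V (\<lambda>A. \<Sum>S\<in>\<S>. \<phi> S * of_bool (splits k S A)) < W"
  proof -
    have "(\<Sum>A\<in>Pow V. 4 * (\<Sum>S\<in>\<S>. \<phi> S * of_bool (splits k S A))) < (\<Sum>A\<in>Pow V. W)"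
      using assms(1) lt by (intro sum_strict_mono) auto
    also have "\<dots> = 2 ^ card V * W" using assms(1) by (simp add: card_Pow)
    finally show ?thesis by (simp add: avg_def field_simps flip: sum_distrib_left)
  qed
  ultimately show False by simp
qed

text \<open>Jensen's inequality for a concave power, obtained from Hoelder against the constant
  1.\<close>

lemma avg_powr_le:
  assumes "finite V" "0 \<le> \<theta>" "\<theta> \<le> 1" "\<And>X. X \<subseteq> V \<Longrightarrow> 0 \<le> f X"
  shows "avg V (\<lambda>X. f X powr \<theta>) \<le> avg V f powr \<theta>"
proof -
  define M where "M = (2::real) ^ card V"
  have M: "M > 0" by (simp add: M_def)
  have "(\<Sum>X\<in>Pow V. f X powr \<theta> * 1 powr (1 - \<theta>)) \<le> (\<Sum>X\<in>Pow V. f X) powr \<theta> * (\<Sum>X\<in>Pow V. 1) powr (1 - \<theta>)"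
    using assms by (intro Holder_sum2) auto
  then have "(\<Sum>X\<in>Pow V. f X powr \<theta>) / M \<le> (\<Sum>X\<in>Pow V. f X) powr \<theta> * M powr (1 - \<theta>) / M"
    using assms(1) by (simp add: card_Pow M_def divide_right_mono)
  also have "\<dots> = (\<Sum>X\<in>Pow V. f X) powr \<theta> / M powr \<theta>"
    using M by (simp add: powr_diff)
  also have "\<dots> = ((\<Sum>X\<in>Pow V. f X) / M) powr \<theta>"
    using M assms by (simp add: powr_divide sum_nonneg)
  finally show ?thesis
    unfolding avg_def M_def .
qed

section \<open>Renyi sums of the spectrum, their level-one bound and the doubling step\<close>

definition levels :: "'a set \<Rightarrow> nat \<Rightarrow> 'a set set" where
  "levels V k = {S. S \<subseteq> V \<and> S \<noteq> {} \<and> card S \<le> k}"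

text \<open>The squared coefficients enter with the power \<open>1 - a\<close>: up to normalisation
  and logarithm this is the Renyi entropy of order \<open>1 - a\<close> of the spectrum on
  \<open>levels V k\<close>.\<close>

definition renyi :: "'a set \<Rightarrow> nat \<Rightarrow> real \<Rightarrow> ('a set \<Rightarrow> real) \<Rightarrow> real" where
  "renyi V k a f = (\<Sum>S\<in>levels V k. \<bar>fcoef V f S\<bar> powr (2 - 2 * a))"

lemma finite_levels: "finite V \<Longrightarrow> finite (levels V k)"
  by (simp add: levels_def)

lemma sum_fcoef_square_le_infl:
  assumes "finite V"
  shows "(\<Sum>S\<in>Pow V - {{}}. (fcoef V f S)\<^sup>2) \<le> infl V f"
proof -
  have "(\<Sum>S\<in>Pow V - {{}}. (fcoef V f S)\<^sup>2) \<le> (\<Sum>S\<in>Pow V - {{}}. real (card S) * (fcoef V f S)\<^sup>2)"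
  proof (intro sum_mono)
    fix S assume "S \<in> Pow V - {{}}"
    then have "1 \<le> card S" using assms finite_subset[of S V] by (simp add: Suc_le_eq card_gt_0_iff)
    then have "1 * (fcoef V f S)\<^sup>2 \<le> real (card S) * (fcoef V f S)\<^sup>2"
      by (intro mult_right_mono) auto
    then show "(fcoef V f S)\<^sup>2 \<le> real (card S) * (fcoef V f S)\<^sup>2" by simp
  qed
  also have "\<dots> \<le> infl V f"
    unfolding infl_def using assms by (intro sum_mono2) auto
  finally show ?thesis .
qed

lemma sum_fcoef_square_le_1:
  assumes "finite V" and f: "f ` Pow V \<subseteq> {0, 1}"
  shows "(\<Sum>S\<in>Pow V. (fcoef V f S)\<^sup>2) \<le> 1"
proof -
  have "(f X)\<^sup>2 \<le> 1" if "X \<subseteq> V" for X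
  proof -
    have "f X \<in> {0, 1}" using f that by blast
    then show ?thesis by auto
  qed
  then have "avg V (\<lambda>X. (f X)\<^sup>2) \<le> avg V (\<lambda>X. 1)"
    by (intro avg_mono)
  then show ?thesis using assms by (simp add: parseval)
qed

text \<open>Hoelder interpolates between the sum of the absolute values, at most
  \<open>2 * infl V f\<close>, and the sum \<open>W\<close> of the squares, at most both
  \<open>infl V f\<close> and 1. This starts the induction and also handles singletons in every
  later step.\<close>

lemma sum_singleton_powr_le:
  assumes "finite V" and f: "f ` Pow V \<subseteq> {0, 1}" and a: "0 < a" "a \<le> 1/3"
  shows "(\<Sum>i\<in>V. \<bar>fcoef V f {i}\<bar> powr (2 - 2 * a)) \<le> 2 * infl V f powr (1 - a)"
proof -
  define I where "I = infl V f"
  define W where "W = (\<Sum>i\<in>V. (fcoef V f {i})\<^sup>2)"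
  have I0: "I \<ge> 0" and W0: "W \<ge> 0" by (simp_all add: I_def infl_nonneg W_def sum_nonneg)
  have W_eq: "W = (\<Sum>S\<in>(\<lambda>i. {i}) ` V. (fcoef V f S)\<^sup>2)"
    unfolding W_def by (simp add: sum.reindex)
  have "W \<le> (\<Sum>S\<in>Pow V - {{}}. (fcoef V f S)\<^sup>2)"
    unfolding W_eq using assms(1) by (intro sum_mono2) auto
  also have "\<dots> \<le> I" unfolding I_def by (rule sum_fcoef_square_le_infl[OF assms(1)])
  finally have WI: "W \<le> I" .
  have "W \<le> (\<Sum>S\<in>Pow V. (fcoef V f S)\<^sup>2)"
    unfolding W_eq using assms(1) by (intro sum_mono2) auto
  also have "\<dots> \<le> 1" by (rule sum_fcoef_square_le_1[OF assms(1,2)])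
  finally have W1: "W \<le> 1" .
  have "(\<Sum>i\<in>V. \<bar>fcoef V f {i}\<bar> powr (2 - 2 * a))
      = (\<Sum>i\<in>V. \<bar>fcoef V f {i}\<bar> powr (2 * a) * ((fcoef V f {i})\<^sup>2) powr (1 - 2 * a))"
  proof (intro sum.cong refl)
    fix i
    show "\<bar>fcoef V f {i}\<bar> powr (2 - 2 * a) = \<bar>fcoef V f {i}\<bar> powr (2 * a) * ((fcoef V f {i})\<^sup>2) powr (1 - 2 * a)"
    proof (cases "fcoef V f {i} = 0")
      case False
      then have "(fcoef V f {i})\<^sup>2 = \<bar>fcoef V f {i}\<bar> powr 2" by simp
      moreover have "2 * a + 2 * (1 - 2 * a) = 2 - 2 * a" by simp
      ultimately show ?thesis by (simp only: powr_powr powr_add [symmetric])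
    qed simp
  qed
  also have "\<dots> \<le> (\<Sum>i\<in>V. \<bar>fcoef V f {i}\<bar>) powr (2 * a) * W powr (1 - 2 * a)"
    unfolding W_def using assms by (intro Holder_sum2) auto
  also have "\<dots> \<le> (2 * I) powr (2 * a) * I powr (1 - 3 * a)"
  proof (intro mult_mono powr_mono2)
    show "(\<Sum>i\<in>V. \<bar>fcoef V f {i}\<bar>) \<le> 2 * I"
      unfolding I_def by (rule sum_abs_fcoef_singleton_le[OF assms(1,2)])
    \<comment> \<open>Lowering the exponent is allowed because \<open>W \<le> 1\<close>; the value
      \<open>1 - 3 * a\<close> makes the total power of \<open>I\<close> equal to
      \<open>1 - a\<close>.\<close>
    show "W powr (1 - 2 * a) \<le> I powr (1 - 3 * a)"
    proof (cases "W = 0")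
      case True then show ?thesis by simp
    next
      case False
      have "W powr (1 - 2 * a) \<le> W powr (1 - 3 * a)"
        using False W0 W1 a by (intro powr_mono') auto
      also have "\<dots> \<le> I powr (1 - 3 * a)" using WI W0 a by (intro powr_mono2) auto
      finally show ?thesis .
    qed
  qed (use a I0 in \<open>auto intro: sum_nonneg\<close>)
  also have "\<dots> = 2 powr (2 * a) * I powr (1 - a)"
    using I0 by (simp add: powr_mult mult.assoc flip: powr_add)
  also have "\<dots> \<le> 2 powr 1 * I powr (1 - a)"
    using a by (intro mult_right_mono powr_mono) auto
  finally show ?thesis by (simp add: I_def)
qed

text \<open>The marginal of \<open>T \<subseteq> A\<close> is the low-level weight of the function \<open>Y \<mapsto> f\<^sub>Y(T)\<close> on the cube over \<open>B\<close>,
  where \<open>f\<^sub>Y\<close> is a restriction of \<open>f\<close> and hence again two-valued.\<close>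

lemma marginal_le:
  assumes fin: "finite A" "finite B" and disj: "A \<inter> B = {}" and f: "f ` Pow (A \<union> B) \<subseteq> {0, 1}"
    and b: "0 < b" "b \<le> 1/3" and D: "D \<ge> 0"
    and IH: "\<And>g. g ` Pow A \<subseteq> {0, 1} \<Longrightarrow> renyi A k b g \<le> (D * infl A g) powr (1 - b)"
  shows "(\<Sum>T\<in>levels A k. (\<Sum>R\<in>levels B k. (fcoef (A \<union> B) f (T \<union> R))\<^sup>2) powr (1 - b))
    \<le> 9 powr (real k * b) * (D * infl (A \<union> B) f) powr (1 - b)"
proof -
  define F where "F T Y = fcoef A (\<lambda>X. f (X \<union> Y)) T" for T Y
  have "(\<Sum>T\<in>levels A k. (\<Sum>R\<in>levels B k. (fcoef (A \<union> B) f (T \<union> R))\<^sup>2) powr (1 - b))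
      = (\<Sum>T\<in>levels A k. (\<Sum>R\<in>levels B k. (fcoef B (F T) R)\<^sup>2) powr (1 - b))"
    using fin disj unfolding F_def [abs_def]
    by (intro sum.cong refl arg_cong[where f="\<lambda>x. x powr (1 - b)"]) (auto simp: fcoef_Un levels_def)
  also have "\<dots> \<le> (\<Sum>T\<in>levels A k. 9 powr (real k * b) * avg B (\<lambda>Y. \<bar>F T Y\<bar> powr (2 - 2 * b)))"
    using fin b by (intro sum_mono low_level_weight_powr_le) (auto simp: levels_def)
  also have "\<dots> = 9 powr (real k * b) * avg B (\<lambda>Y. renyi A k b (\<lambda>X. f (X \<union> Y)))"
    by (simp add: sum_distrib_left renyi_def avg_sum F_def)
  also have "\<dots> \<le> 9 powr (real k * b) * avg B (\<lambda>Y. (D * infl A (\<lambda>X. f (X \<union> Y))) powr (1 - b))"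
  proof (intro mult_left_mono avg_mono IH)
    fix Y assume "Y \<subseteq> B"
    then have "X \<union> Y \<in> Pow (A \<union> B)" if "X \<in> Pow A" for X using that by auto
    then show "(\<lambda>X. f (X \<union> Y)) ` Pow A \<subseteq> {0, 1}"
      using f unfolding image_subset_iff by metis
  qed auto
  also have "\<dots> \<le> 9 powr (real k * b) * (D * infl (A \<union> B) f) powr (1 - b)"
  proof (rule mult_left_mono)
    have "avg B (\<lambda>Y. (D * infl A (\<lambda>X. f (X \<union> Y))) powr (1 - b))
        \<le> (D * avg B (\<lambda>Y. infl A (\<lambda>X. f (X \<union> Y)))) powr (1 - b)"
      using avg_powr_le[OF fin(2), of "1 - b" "\<lambda>Y. D * infl A (\<lambda>X. f (X \<union> Y))"] b D
      by (simp add: avg_cmult infl_nonneg)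
    also have "\<dots> \<le> (D * infl (A \<union> B) f) powr (1 - b)"
    proof (rule powr_mono2)
      show "D * avg B (\<lambda>Y. infl A (\<lambda>X. f (X \<union> Y))) \<le> D * infl (A \<union> B) f"
        by (rule mult_left_mono[OF avg_infl_restrict_le[OF fin disj] D])
      show "0 \<le> D * avg B (\<lambda>Y. infl A (\<lambda>X. f (X \<union> Y)))"
        by (rule mult_nonneg_nonneg[OF D avg_nonneg[OF infl_nonneg]])
    qed (use b in simp)
    finally show "avg B (\<lambda>Y. (D * infl A (\<lambda>X. f (X \<union> Y))) powr (1 - b)) \<le> (D * infl (A \<union> B) f) powr (1 - b)" .
  qed simp
  finally show ?thesis .
qed

text \<open>The doubling step: a bound at level \<open>k\<close> with exponent \<open>b\<close>
  gives one at the larger level \<open>k'\<close> with exponent \<open>a\<close>, about half of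
  \<open>b\<close>. The linear dependence on the influence survives because
  \<open>(1 - b) * (1 + a) = 1 - a\<close>.\<close>

lemma renyi_step:
  fixes V :: "'a set"
  assumes V: "finite V" and f: "f ` Pow V \<subseteq> {0, 1}"
    and a: "0 < a" "a \<le> 1/5" and b: "b = 2 * a / (1 + a)" and D: "D \<ge> 1"
    and k: "k' \<le> k + 1 \<or> k' < 2 * k \<and> 4 * k' \<le> (2 * k - k')\<^sup>2" and ka: "4 * (real k * a) \<le> 1"
    and IH: "\<And>A (g :: 'a set \<Rightarrow> real). finite A \<Longrightarrow> g ` Pow A \<subseteq> {0, 1} \<Longrightarrow>
        renyi A k b g \<le> (D * infl A g) powr (1 - b)"
  shows "renyi V k' a f \<le> (125 * D * infl V f) powr (1 - a)"
proof -
  define I where "I = infl V f"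
  have I0: "I \<ge> 0" by (simp add: I_def infl_nonneg)
  define \<phi> where "\<phi> S = \<bar>fcoef V f S\<bar> powr (2 - 2 * a)" for S
  have \<phi>: "\<phi> S \<ge> 0" for S by (simp add: \<phi>_def)
  have b': "0 < b" "b \<le> 1/3" "(1 - b) * (1 + a) = 1 - a" "b * (1 + a) = 2 * a"
    using a unfolding b by (auto simp: field_simps)
  \<comment> \<open>Singletons cannot be cut into two nonempty parts; they are bounded separately at
    the end.\<close>
  define \<S> where "\<S> = {S \<in> levels V k'. 2 \<le> card S}"
  have \<S>: "\<And>S. S \<in> \<S> \<Longrightarrow> S \<subseteq> V \<and> 2 \<le> card S \<and> card S \<le> k'"
    by (auto simp: \<S>_def levels_def)
  obtain A where A: "A \<subseteq> V" and le: "(\<Sum>S\<in>\<S>. \<phi> S) \<le> 4 * (\<Sum>S\<in>{S \<in> Pow V. splits k S A}. \<phi> S)"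
    using exists_good_split[of V \<phi> \<S> k' k, OF V \<phi> \<S> k] by blast
  define B where "B = V - A"
  have AB: "finite A" "finite B" "A \<inter> B = {}" "A \<union> B = V" "B \<inter> A = {}" "B \<union> A = V"
    using A V by (auto simp: B_def dest: finite_subset)
  define P where "P T R = (fcoef V f (T \<union> R))\<^sup>2" for T R
  have P_powr: "P T R powr (1 - a) = \<phi> (T \<union> R)" for T R
  proof (cases "fcoef V f (T \<union> R) = 0")
    case False
    then have "P T R = \<bar>fcoef V f (T \<union> R)\<bar> powr 2" by (simp add: P_def)
    then have "P T R powr (1 - a) = \<bar>fcoef V f (T \<union> R)\<bar> powr (2 * (1 - a))"
      by (simp only: powr_powr)
    then show ?thesis by (simp add: \<phi>_def algebra_simps)
  qed (use a in \<open>simp add: P_def \<phi>_def\<close>)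
  have "(\<Sum>S\<in>{S \<in> Pow V. splits k S A}. \<phi> S) = (\<Sum>p\<in>levels A k \<times> levels B k. \<phi> (fst p \<union> snd p))"
  proof (rule sum.reindex_bij_witness[where i="\<lambda>p. fst p \<union> snd p" and j="\<lambda>S. (S \<inter> A, S - A)"])
    fix p assume "p \<in> levels A k \<times> levels B k"
    then obtain T R where p: "p = (T, R)" "T \<subseteq> A" "R \<subseteq> B" "T \<noteq> {}" "R \<noteq> {}" "card T \<le> k" "card R \<le> k"
      by (auto simp: levels_def)
    moreover have "(T \<union> R) \<inter> A = T" "(T \<union> R) - A = R" using p AB by auto
    moreover have "finite T" "finite R" using p AB by (auto dest: finite_subset)
    ultimately show "fst p \<union> snd p \<in> {S \<in> Pow V. splits k S A}"
      "((fst p \<union> snd p) \<inter> A, (fst p \<union> snd p) - A) = p"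
      using AB by (auto simp: splits_def Suc_le_eq card_gt_0_iff)
  next
    fix S assume S: "S \<in> {S \<in> Pow V. splits k S A}"
    then show "fst (S \<inter> A, S - A) \<union> snd (S \<inter> A, S - A) = S"
      "\<phi> (fst (S \<inter> A, S - A) \<union> snd (S \<inter> A, S - A)) = \<phi> S"
      by (simp_all add: Int_Diff_Un)
    have "card (S \<inter> A) \<noteq> 0" "card (S - A) \<noteq> 0" using S by (auto simp: splits_def)
    then have "S \<inter> A \<noteq> {}" "S - A \<noteq> {}" by (metis card.empty)+
    with S show "(S \<inter> A, S - A) \<in> levels A k \<times> levels B k"
      by (auto simp: splits_def levels_def B_def)
  qed
  also have "\<dots> = (\<Sum>T\<in>levels A k. \<Sum>R\<in>levels B k. P T R powr (1 - a))"
    by (simp add: P_powr sum.cartesian_product case_prod_unfold)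
  also have "\<dots> \<le> ((\<Sum>T\<in>levels A k. (\<Sum>R\<in>levels B k. P T R) powr (1 - b))
      * (\<Sum>R\<in>levels B k. (\<Sum>T\<in>levels A k. P T R) powr (1 - b))) powr ((1 + a) / 2)"
    using AB a b by (intro Renyi_subadditivity finite_levels) (auto simp: P_def)
  also have "\<dots> \<le> ((9 powr (real k * b) * (D * I) powr (1 - b)) * (9 powr (real k * b) * (D * I) powr (1 - b)))
       powr ((1 + a) / 2)"
  proof (intro powr_mono2 mult_mono)
    show "(\<Sum>T\<in>levels A k. (\<Sum>R\<in>levels B k. P T R) powr (1 - b)) \<le> 9 powr (real k * b) * (D * I) powr (1 - b)"
      using marginal_le[OF AB(1,2,3) _ b'(1,2), of f D k, OF _ _ IH[OF AB(1)]] f D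
      unfolding AB P_def I_def by simp
    show "(\<Sum>R\<in>levels B k. (\<Sum>T\<in>levels A k. P T R) powr (1 - b)) \<le> 9 powr (real k * b) * (D * I) powr (1 - b)"
      using marginal_le[OF AB(2,1,5) _ b'(1,2), of f D k, OF _ _ IH[OF AB(2)]] f D
      unfolding AB P_def I_def by (simp add: Un_commute)
  qed (use a in \<open>auto intro!: sum_nonneg mult_nonneg_nonneg\<close>)
  also have "\<dots> = (9 powr (real k * b) * (D * I) powr (1 - b)) powr (1 + a)"
  proof -
    have "(x * x) powr (c / 2) = x powr c" for x c :: real
      by (simp add: powr_mult flip: powr_add)
    then show ?thesis .
  qed
  also have "\<dots> = 9 powr (2 * (real k * a)) * (D * I) powr (1 - a)"
  proof -
    have "real k * b * (1 + a) = 2 * (real k * a)" using b'(4) by (simp add: mult.assoc)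
    moreover have "(9 powr (real k * b) * (D * I) powr (1 - b)) powr (1 + a)
        = 9 powr (real k * b * (1 + a)) * (D * I) powr ((1 - b) * (1 + a))"
      by (simp only: powr_mult powr_powr)
    ultimately show ?thesis by (simp only: b'(3))
  qed
  \<comment> \<open>Here \<open>k * a \<le> 1/4\<close> keeps the hypercontractive loss at 3; with
    the factor 4 from the choice of \<open>A\<close> this makes 12.\<close>
  also have "\<dots> \<le> 9 powr (1/2) * (D * I) powr (1 - a)"
    using ka by (intro mult_right_mono powr_mono) auto
  finally have "(\<Sum>S\<in>\<S>. \<phi> S) \<le> 12 * (D * I) powr (1 - a)"
    using le by (simp add: powr_half_sqrt real_sqrt_eq_iff[of 9 "3\<^sup>2", simplified])
  moreover have "(\<Sum>i\<in>V. \<phi> {i}) \<le> 2 * (D * I) powr (1 - a)"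
  proof -
    have "(\<Sum>i\<in>V. \<phi> {i}) \<le> 2 * I powr (1 - a)"
      unfolding \<phi>_def I_def using a by (intro sum_singleton_powr_le V f) auto
    also have "\<dots> \<le> 2 * (D * I) powr (1 - a)"
      using a D I0 mult_right_mono[OF D I0] by (intro mult_left_mono powr_mono2) auto
    finally show ?thesis .
  qed
  moreover have "renyi V k' a f \<le> (\<Sum>S\<in>\<S>. \<phi> S) + (\<Sum>i\<in>V. \<phi> {i})"
  proof -
    have "renyi V k' a f = (\<Sum>S\<in>levels V k'. \<phi> S)" by (simp add: renyi_def \<phi>_def)
    also have "\<dots> \<le> (\<Sum>S\<in>\<S> \<union> (\<lambda>i. {i}) ` V. \<phi> S)"
    proof (rule sum_mono2)
      show "levels V k' \<subseteq> \<S> \<union> (\<lambda>i. {i}) ` V"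
      proof
        fix S assume S: "S \<in> levels V k'"
        then have "card S \<noteq> 0" using V by (auto simp: levels_def finite_subset)
        then have "card S = 1 \<or> 2 \<le> card S" by linarith
        then show "S \<in> \<S> \<union> (\<lambda>i. {i}) ` V"
          using S by (auto simp: \<S>_def levels_def card_1_singleton_iff)
      qed
    qed (use V \<phi> in \<open>auto simp: \<S>_def finite_levels\<close>)
    also have "\<dots> = (\<Sum>S\<in>\<S>. \<phi> S) + (\<Sum>S\<in>(\<lambda>i. {i}) ` V. \<phi> S)"
      using V by (intro sum.union_disjoint) (auto simp: \<S>_def finite_levels)
    also have "(\<Sum>S\<in>(\<lambda>i. {i}) ` V. \<phi> S) = (\<Sum>i\<in>V. \<phi> {i})" by (simp add: sum.reindex)
    finally show ?thesis .
  qed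
  ultimately have "renyi V k' a f \<le> 14 * (D * I) powr (1 - a)" by simp
  also have "\<dots> \<le> 125 powr (1 - a) * (D * I) powr (1 - a)"
  proof (rule mult_right_mono)
    \<comment> \<open>The 14 consists of 12 from the split sets and 2 from the singletons. It is
      moved inside the power, so that the bound keeps the shape of the induction hypothesis.\<close>
    have "(14::real) \<le> 125 powr (2/3)"
    proof -
      have "(125::real) powr (2/3) = (5 powr 3) powr (2/3)" by simp
      also have "\<dots> = 25" by (simp only: powr_powr) simp
      finally show ?thesis by simp
    qed
    also have "\<dots> \<le> 125 powr (1 - a)" using a by (intro powr_mono) auto
    finally show "14 \<le> (125::real) powr (1 - a)" .
  qed simp
  also have "\<dots> = (125 * D * I) powr (1 - a)"
    by (simp add: powr_mult mult.assoc)
  finally show ?thesis by (simp add: I_def)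
qed

section \<open>Iterating the doubling step along a sequence of levels\<close>

text \<open>A set is cut only nearly in half, so each doubling falls short by a term of order
  \<open>sqrt (\<kappa> r)\<close>. These relative losses are summable, hence
  \<open>\<kappa> r\<close> stays within a constant factor of \<open>2 ^ r\<close>.\<close>

lemma exists_scales:
  "\<exists>\<kappa> :: nat \<Rightarrow> nat. \<kappa> 0 = 1 \<and> (\<forall>r. \<kappa> r \<le> 2 ^ r \<and> 2 ^ r \<le> 2 ^ 35 * \<kappa> r) \<and>
    (\<forall>r. \<kappa> (Suc r) \<le> \<kappa> r + 1 \<or>
      \<kappa> (Suc r) < 2 * \<kappa> r \<and> 4 * \<kappa> (Suc r) \<le> (2 * \<kappa> r - \<kappa> (Suc r))\<^sup>2)"
proof -
  \<comment> \<open>The shortfall \<open>e k\<close> satisfies \<open>8 * k \<le> (e k)^2\<close>,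
    which is the Chebyshev condition for any new level below \<open>2 * k\<close>. While
    \<open>2 * k - e k\<close> is not yet larger, the level grows by 1.\<close>
  define e where "e k = nat \<lceil>sqrt (8 * real k)\<rceil>" for k :: nat
  define nxt where "nxt k = max (k + 1) (2 * k - e k)" for k
  define \<kappa> where "\<kappa> r = (nxt ^^ r) 1" for r
  have e_ge: "sqrt (8 * real k) \<le> real (e k)" for k
    unfolding e_def by linarith
  have e_le: "real (e k) \<le> sqrt (8 * real k) + 1" for k
  proof -
    have "0 \<le> sqrt (8 * real k)" by simp
    then show ?thesis unfolding e_def by linarith
  qed
  have e_sq: "8 * k \<le> (e k)\<^sup>2" for k
  proof -
    have "(sqrt (8 * real k))\<^sup>2 \<le> (real (e k))\<^sup>2" using e_ge by (intro power_mono) auto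
    then have "real (8 * k) \<le> real ((e k)\<^sup>2)" by simp
    then show ?thesis by (simp only: of_nat_le_iff)
  qed
  have \<kappa>_Suc: "\<kappa> (Suc r) = nxt (\<kappa> r)" for r by (simp add: \<kappa>_def)
  have \<kappa>_0: "\<kappa> 0 = 1" by (simp add: \<kappa>_def)
  have ge: "r + 1 \<le> \<kappa> r" for r
    by (induction r) (auto simp: \<kappa>_0 \<kappa>_Suc nxt_def)
  have le: "\<kappa> r \<le> 2 ^ r" for r
  proof (induction r)
    case (Suc r)
    then show ?case using ge[of r] by (auto simp: \<kappa>_Suc nxt_def)
  qed (simp add: \<kappa>_0)
  have step: "\<kappa> (Suc r) \<le> \<kappa> r + 1 \<or>
      \<kappa> (Suc r) < 2 * \<kappa> r \<and> 4 * \<kappa> (Suc r) \<le> (2 * \<kappa> r - \<kappa> (Suc r))\<^sup>2" for r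
  proof (cases "\<kappa> (Suc r) \<le> \<kappa> r + 1")
    case False
    then have eq: "\<kappa> (Suc r) = 2 * \<kappa> r - e (\<kappa> r)" "e (\<kappa> r) < 2 * \<kappa> r"
      by (auto simp: \<kappa>_Suc nxt_def max_def split: if_splits)
    then have "2 * \<kappa> r - \<kappa> (Suc r) = e (\<kappa> r)" "4 * \<kappa> (Suc r) \<le> 8 * \<kappa> r" by auto
    moreover have "e (\<kappa> r) \<noteq> 0"
    proof
      assume "e (\<kappa> r) = 0"
      then show False using e_sq[of "\<kappa> r"] ge[of r] by simp
    qed
    ultimately show ?thesis using eq e_sq[of "\<kappa> r"] by auto
  qed simp
  \<comment> \<open>The shift by 5 absorbs the lower-order loss in the induction. The start at 35
    fits since \<open>\<kappa> 35 \<ge> 36 = (1 + 5)^2\<close>.\<close>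
  have growth: "(sqrt 2 ^ j + 5)\<^sup>2 \<le> real (\<kappa> (35 + j))" for j
  proof (induction j)
    case 0
    then show ?case using ge[of 35] by simp
  next
    case (Suc j)
    define s where "s = sqrt 2"
    define x where "x = s ^ j"
    define y where "y = sqrt (real (\<kappa> (35 + j)))"
    have s: "s * s = 2" "1 \<le> s" "s < 1.42"
      unfolding s_def by (simp, simp, rule real_less_lsqrt) (auto simp: power2_eq_square)
    have x: "x \<ge> 1" using s by (simp add: x_def)
    have y2: "y * y = real (\<kappa> (35 + j))" by (simp add: y_def)
    have "(x + 5)\<^sup>2 \<le> real (\<kappa> (35 + j))" using Suc by (simp add: x_def s_def)
    then have xy: "x + 5 \<le> y" unfolding y_def by (rule real_le_rsqrt)
    have "sqrt (8 * real (\<kappa> (35 + j))) = 2 * s * y"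
      unfolding s_def y_def real_sqrt_mult[symmetric] using real_sqrt_mult[of 4 "2 * real (\<kappa> (35 + j))"]
      by (simp add: real_sqrt_mult)
    then have "real (e (\<kappa> (35 + j))) \<le> 2 * s * y + 1" using e_le[of "\<kappa> (35 + j)"] by simp
    moreover have "real (\<kappa> (35 + Suc j)) \<ge> 2 * real (\<kappa> (35 + j)) - real (e (\<kappa> (35 + j)))"
      using \<kappa>_Suc[of "35 + j"] by (simp only: add_Suc_right) (simp add: nxt_def)
    ultimately have "real (\<kappa> (35 + Suc j)) \<ge> 2 * y * (y - s) - 1"
      using y2 by (simp add: algebra_simps)
    moreover have "2 * (x + 5) * (x + 5 - s) \<le> 2 * y * (y - s)"
      using xy x s by (intro mult_mono) auto
    moreover have "(s * x + 5)\<^sup>2 \<le> 2 * (x + 5) * (x + 5 - s) - 1"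
    proof -
      \<comment> \<open>With \<open>s\<close> the square root of 2 the quadratic term vanishes; the
        other two are positive since \<open>s < 1.42\<close>.\<close>
      have "2 * (x + 5) * (x + 5 - s) - 1 - (s * x + 5)\<^sup>2
          = (2 - s * s) * (x * x) + (20 - 12 * s) * x + (49 - 10 * s - 25)"
        by (simp add: power2_eq_square algebra_simps)
      also have "\<dots> \<ge> 0" using s x by simp
      finally show ?thesis by simp
    qed
    ultimately have "(s * x + 5)\<^sup>2 \<le> real (\<kappa> (35 + Suc j))" by linarith
    then show ?case by (simp add: s_def x_def)
  qed
  have lower: "2 ^ r \<le> 2 ^ 35 * \<kappa> r" for r
  proof (cases "r \<le> 35")
    case True
    then have "(2::nat) ^ r \<le> 2 ^ 35" by (rule power_increasing) simp
    also have "\<dots> \<le> 2 ^ 35 * \<kappa> r" using ge[of r] by simp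
    finally show ?thesis .
  next
    case False
    then obtain j where r: "r = 35 + j" using le_Suc_ex[of 35 r] by auto
    have "real (2 ^ j) = (sqrt 2 ^ j)\<^sup>2"
      by (simp add: power_mult [symmetric] mult.commute [of j]) (simp add: power_mult)
    also have "\<dots> \<le> (sqrt 2 ^ j + 5)\<^sup>2" by (intro power_mono) auto
    also have "\<dots> \<le> real (\<kappa> r)" using growth[of j] r by simp
    finally have "2 ^ j \<le> \<kappa> r" by (simp only: of_nat_le_iff)
    then show ?thesis by (simp add: r power_add)
  qed
  show ?thesis
    using \<kappa>_0 le lower step by blast
qed

text \<open>The solution of the recursion \<open>b = 2 * a / (1 + a)\<close> of the doubling step,
  under which \<open>1 / a - 1\<close> doubles, starting from 1/3, the largest exponent allowed at
  level one.\<close>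

definition rexp :: "nat \<Rightarrow> real" where
  "rexp r = 1 / (1 + 2 ^ (r + 1))"

lemma rexp_bounds: "0 < rexp r" "rexp r \<le> 1/3" "1 \<le> 2 ^ (r + 2) * rexp r"
proof -
  have "(2::real) ^ 1 \<le> 2 ^ (r + 1)" by (intro power_increasing) auto
  then show "rexp r \<le> 1/3" unfolding rexp_def by (intro divide_left_mono mult_pos_pos add_pos_pos) auto
  show "0 < rexp r" by (simp add: rexp_def add_pos_pos)
  show "1 \<le> 2 ^ (r + 2) * rexp r"
  proof -
    have "1 + 2 ^ (r + 1) \<le> (2::real) ^ (r + 2)" using one_le_power[of "2::real" "r + 1"] by simp
    then show ?thesis by (simp add: rexp_def le_divide_eq add_pos_pos)
  qed
qed

text \<open>Each doubling costs a factor 125, so the total \<open>125 ^ (r + 1)\<close> is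
  polynomial in \<open>2 ^ r\<close>. The induction generalises over \<open>V\<close> and
  \<open>f\<close> because it is applied to restrictions on both parts of a partition.\<close>

lemma renyi_scale_le:
  fixes V :: "'a set"
  assumes \<kappa>0: "\<kappa> 0 = 1" and \<kappa>: "\<And>r. \<kappa> r \<le> 2 ^ r"
    and split: "\<And>r. \<kappa> (Suc r) \<le> \<kappa> r + 1 \<or>
      \<kappa> (Suc r) < 2 * \<kappa> r \<and> 4 * \<kappa> (Suc r) \<le> (2 * \<kappa> r - \<kappa> (Suc r))\<^sup>2"
    and "finite V" "f ` Pow V \<subseteq> {0, 1}"
  shows "renyi V (\<kappa> r) (rexp r) f \<le> (125 ^ (r + 1) * infl V f) powr (1 - rexp r)"
  using assms(4,5)
proof (induction r arbitrary: V f)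
  case 0
  have "levels V 1 = (\<lambda>i. {i}) ` V"
  proof -
    have "S \<in> (\<lambda>i. {i}) ` V" if "S \<subseteq> V" "S \<noteq> {}" "card S \<le> 1" for S
    proof -
      have "card S \<noteq> 0" using that 0 finite_subset[of S V] by simp
      then have "card S = 1" using that by simp
      then show ?thesis using that by (auto simp: card_1_singleton_iff)
    qed
    then show ?thesis by (auto simp: levels_def)
  qed
  then have "renyi V (\<kappa> 0) (rexp 0) f = (\<Sum>i\<in>V. \<bar>fcoef V f {i}\<bar> powr (2 - 2 * rexp 0))"
    by (simp add: renyi_def \<kappa>0 sum.reindex)
  also have "\<dots> \<le> 2 * infl V f powr (1 - rexp 0)"
    using 0 by (intro sum_singleton_powr_le rexp_bounds)
  also have "\<dots> \<le> 125 powr (1 - rexp 0) * infl V f powr (1 - rexp 0)"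
  proof (rule mult_right_mono)
    have "(2::real) = 8 powr (1/3)" using powr_powr[of 2 3 "1/3::real"] by simp
    also have "\<dots> \<le> 125 powr (1/3)" by (intro powr_mono2) auto
    also have "\<dots> \<le> 125 powr (1 - rexp 0)" by (intro powr_mono) (auto simp: rexp_def)
    finally show "2 \<le> (125::real) powr (1 - rexp 0)" .
  qed simp
  finally show ?case by (simp add: powr_mult)
next
  case (Suc r)
  have "renyi V (\<kappa> (Suc r)) (rexp (Suc r)) f \<le> (125 * 125 ^ (r + 1) * infl V f) powr (1 - rexp (Suc r))"
  proof (rule renyi_step[OF Suc.prems _ _ _ _ split, where b = "rexp r"])
    have "(2::real) ^ 2 \<le> 2 ^ (Suc r + 1)" by (intro power_increasing) auto
    then show "rexp (Suc r) \<le> 1/5" unfolding rexp_def by (intro divide_left_mono mult_pos_pos add_pos_pos) auto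
    show "rexp r = 2 * rexp (Suc r) / (1 + rexp (Suc r))"
    proof -
      have "(1::real) + 4 * 2 ^ r \<noteq> 0" "(2::real) + 4 * 2 ^ r \<noteq> 0" "(1::real) + 2 * 2 ^ r \<noteq> 0"
        by (auto simp: add_pos_pos less_imp_neq[symmetric] intro!: less_imp_neq[symmetric])
      then show ?thesis by (simp add: rexp_def divide_simps) (simp add: algebra_simps)
    qed
    \<comment> \<open>The upper bound on \<open>\<kappa> r\<close> makes the level times the
      exponent at most 1/4, as \<open>renyi_step\<close> requires.\<close>
    have "real (\<kappa> r) \<le> real (2 ^ r)" using \<kappa>[of r] by (rule of_nat_mono)
    then have "4 * real (\<kappa> r) \<le> 1 + 4 * 2 ^ r" unfolding of_nat_power of_nat_numeral by linarith
    then have "4 * real (\<kappa> r) \<le> 1 + 2 ^ (Suc r + 1)" by simp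
    then show "4 * (real (\<kappa> r) * rexp (Suc r)) \<le> 1"
      unfolding rexp_def by (simp add: divide_le_eq add_pos_pos)
    show "renyi A (\<kappa> r) (rexp r) g \<le> (125 ^ (r + 1) * infl A g) powr (1 - rexp r)"
      if "finite A" "g ` Pow A \<subseteq> {0, 1}" for A :: "'a set" and g
      using Suc.IH[OF that] .
    show "(1::real) \<le> 125 ^ (r + 1)" by (rule one_le_power) simp
  qed (rule rexp_bounds)
  then show ?case by simp
qed

section \<open>Large coefficients\<close>

text \<open>The variance in spectral form; see \<open>cube_var_eq_weight\<close>.\<close>

definition weight :: "'a set \<Rightarrow> ('a set \<Rightarrow> real) \<Rightarrow> real" where
  "weight V f = (\<Sum>S\<in>Pow V - {{}}. (fcoef V f S)\<^sup>2)"

lemma weight_le_infl: "finite V \<Longrightarrow> weight V f \<le> infl V f"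
  unfolding weight_def by (rule sum_fcoef_square_le_infl)

text \<open>Markov's inequality for the level under the spectral weights: levels above twice the
  mean level \<open>infl V f / weight V f\<close> carry at most half.\<close>

lemma low_level_weight_ge:
  assumes "finite V" "0 < weight V f"
  shows "weight V f / 2 \<le> (\<Sum>S\<in>levels V (nat \<lfloor>2 * (infl V f / weight V f)\<rfloor>). (fcoef V f S)\<^sup>2)"
proof -
  define v where "v = weight V f"
  define N where "N = infl V f / v"
  have v: "v > 0" using assms by (simp add: v_def)
  have N: "N \<ge> 1" using weight_le_infl[OF assms(1), of f] v by (simp add: N_def v_def)
  define K where "K = nat \<lfloor>2 * N\<rfloor>"
  have K: "card S \<le> K \<longleftrightarrow> real (card S) \<le> 2 * N" for S :: "'a set"
    using N unfolding K_def by linarith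
  define H where "H = (Pow V - {{}}) - levels V K"
  have "(\<Sum>S\<in>H. (fcoef V f S)\<^sup>2) * (2 * N) \<le> (\<Sum>S\<in>H. real (card S) * (fcoef V f S)\<^sup>2)"
    unfolding sum_distrib_right
  proof (rule sum_mono)
    fix S assume "S \<in> H"
    then have "2 * N \<le> real (card S)" using K[of S] by (auto simp: H_def levels_def)
    then show "(fcoef V f S)\<^sup>2 * (2 * N) \<le> real (card S) * (fcoef V f S)\<^sup>2"
      by (simp add: mult.commute mult_right_mono)
  qed
  also have "\<dots> \<le> infl V f"
    unfolding infl_def using assms(1) by (intro sum_mono2) (auto simp: H_def)
  also have "\<dots> = N * v" using v by (simp add: N_def)
  finally have "(\<Sum>S\<in>H. (fcoef V f S)\<^sup>2) \<le> v / 2" using N by simp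
  moreover have "v = (\<Sum>S\<in>levels V K. (fcoef V f S)\<^sup>2) + (\<Sum>S\<in>H. (fcoef V f S)\<^sup>2)"
    unfolding v_def weight_def H_def using assms(1)
    by (subst sum.subset_diff[of "levels V K"]) (auto simp: levels_def)
  ultimately show ?thesis unfolding K_def N_def v_def by simp
qed

text \<open>Chosen so that \<open>2 * ln 2 * coef_const = 316 * 2 ^ 38\<close>. Here
  \<open>2 ^ 38\<close> compensates for \<open>card S * rexp r\<close> on the scale of
  \<open>S\<close>, and 316 is 312 for the sum over the scales, 1 for a factor \<open>1 + N\<close>,
  and 3 to spare.\<close>

definition coef_const :: real where
  "coef_const = 158 * 2 ^ 38 / ln 2"

lemma coef_const_pos: "coef_const > 0"
  by (simp add: coef_const_def)

text \<open>Sets of size between \<open>\<kappa> (r - 1)\<close> and \<open>\<kappa> r\<close> are treated with the exponent \<open>rexp r\<close>, which is of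
  the order of the inverse of their size; this is why the size of \<open>S\<close> itself, and not the cutoff
  \<open>2 * N\<close>, appears in the bound.\<close>

lemma exists_large_fcoef:
  fixes V :: "'a set"
  assumes V: "finite V" and f: "f ` Pow V \<subseteq> {0, 1}" and pos: "0 < weight V f"
    and N: "N = infl V f / weight V f"
  shows "\<exists>S. S \<noteq> {} \<and> S \<subseteq> V \<and> real (card S) \<le> 2 * N \<and>
    2 powr (- (coef_const * real (card S) * ln (1 + N))) * sqrt (weight V f) \<le> \<bar>fcoef V f S\<bar>"
proof (rule ccontr)
  assume neg: "\<not> ?thesis"
  define v where "v = weight V f"
  have v: "v > 0" using pos by (simp add: v_def)
  have N1: "N \<ge> 1" using weight_le_infl[OF V, of f] v by (simp add: N v_def)
  have I: "infl V f = N * v" using v by (simp add: N v_def)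
  define K where "K = nat \<lfloor>2 * N\<rfloor>"
  have small: "\<bar>fcoef V f S\<bar> \<le> 2 powr (- (coef_const * real (card S) * ln (1 + N))) * sqrt v"
    if "S \<in> levels V K" for S
  proof -
    have "real (card S) \<le> 2 * N" using that N1 unfolding levels_def K_def by auto linarith
    then show ?thesis using neg that unfolding levels_def v_def by force
  qed
  obtain \<kappa> :: "nat \<Rightarrow> nat" where \<kappa>: "\<kappa> 0 = 1" "\<And>r. \<kappa> r \<le> 2 ^ r" "\<And>r. 2 ^ r \<le> 2 ^ 35 * \<kappa> r"
    and split: "\<And>r. \<kappa> (Suc r) \<le> \<kappa> r + 1 \<or>
      \<kappa> (Suc r) < 2 * \<kappa> r \<and> 4 * \<kappa> (Suc r) \<le> (2 * \<kappa> r - \<kappa> (Suc r))\<^sup>2"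
    using exists_scales by blast
  have \<kappa>_lower: "2 ^ r \<le> 2 ^ 35 * real (\<kappa> r)" for r
  proof -
    have "real (2 ^ r) \<le> real (2 ^ 35 * \<kappa> r)" using \<kappa>(3) by (rule of_nat_mono)
    then show ?thesis by simp
  qed
  define p where "p = nat \<lceil>log 2 (1 + N)\<rceil>"
  have p: "1 + N \<le> 2 ^ p" "2 ^ p \<le> 2 * (1 + N)"
  proof -
    have l: "log 2 (1 + N) \<ge> 0" using N1 by simp
    have "1 + N = 2 powr (log 2 (1 + N))" using N1 by simp
    also have "\<dots> \<le> 2 powr real p" using l unfolding p_def by (intro powr_mono) linarith+
    finally show "1 + N \<le> 2 ^ p" by (simp add: powr_realpow)
    have "2 powr real p \<le> 2 powr (1 + log 2 (1 + N))"
      using l unfolding p_def by (intro powr_mono) linarith+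
    also have "\<dots> = 2 * (1 + N)" using N1 by (simp add: powr_add)
    finally show "2 ^ p \<le> 2 * (1 + N)" by (simp add: powr_realpow)
  qed
  \<comment> \<open>The last scale: \<open>2 ^ R\<close> is at least
    \<open>2 ^ 35 * (2 * N)\<close>, so \<open>\<kappa> R\<close> reaches the cutoff.\<close>
  define R where "R = 36 + p"
  have KR: "K \<le> \<kappa> R"
  proof -
    have "2 ^ 35 * (2 * N) \<le> (2::real) ^ 35 * (2 * 2 ^ p)" using p by simp
    also have "\<dots> = 2 ^ R" by (simp add: R_def power_add)
    also have "\<dots> \<le> 2 ^ 35 * real (\<kappa> R)" by (rule \<kappa>_lower)
    finally have "2 * N \<le> real (\<kappa> R)" by simp
    then show ?thesis unfolding K_def by linarith
  qed
  \<comment> \<open>The sets to be treated at scale \<open>r\<close>: small enough for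
    \<open>renyi_scale_le\<close>, large enough for the exponent to be at least of the order of the
    inverse size.\<close>
  define \<G> where "\<G> r = {S \<in> levels V K. card S \<le> \<kappa> r \<and> 1 \<le> 2 ^ 38 * (real (card S) * rexp r)}" for r
  have cover: "\<exists>r\<le>R. S \<in> \<G> r" if S: "S \<in> levels V K" for S
  proof -
    define r where "r = (LEAST r. card S \<le> \<kappa> r)"
    have ex: "card S \<le> \<kappa> R" using S KR by (simp add: levels_def)
    then have r: "card S \<le> \<kappa> r" "r \<le> R" unfolding r_def by (auto intro: LeastI Least_le)
    have card1: "1 \<le> real (card S)"
      using S V finite_subset[of S V] by (simp add: levels_def Suc_le_eq card_gt_0_iff)
    \<comment> \<open>Minimality of \<open>r\<close> gives \<open>card S > \<kappa> (r - 1)\<close>,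
      at least \<open>2 ^ (r - 1)\<close> over \<open>2 ^ 35\<close>; together with
      \<open>rexp r \<ge> 2 powr (- (r + 2))\<close> this makes \<open>2 ^ 38\<close>.\<close>
    have "1 \<le> 2 ^ 38 * (real (card S) * rexp r)"
    proof (cases r)
      case 0
      have "1/3 \<le> real (card S) * rexp 0" using card1 by (simp add: rexp_def)
      then show ?thesis using 0 by simp
    next
      case (Suc q)
      then have "\<not> card S \<le> \<kappa> q" unfolding r_def by (metis lessI not_less_Least)
      then have "2 ^ q \<le> 2 ^ 35 * real (card S)" using \<kappa>_lower[of q] by simp
      then have "2 ^ (r + 2) \<le> 2 ^ 38 * real (card S)" using Suc by simp
      then have "2 ^ (r + 2) * rexp r \<le> 2 ^ 38 * real (card S) * rexp r"
        using rexp_bounds(1)[of r] by (intro mult_right_mono) auto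
      with rexp_bounds(3)[of r] show ?thesis by (simp only: mult.assoc)
    qed
    then show ?thesis using S r by (auto simp: \<G>_def)
  qed
  have scale: "(\<Sum>S\<in>\<G> r. (fcoef V f S)\<^sup>2) \<le> (1 + N) powr (- 315) * v * 125 ^ (r + 1)" for r
  proof -
    define a where "a = rexp r"
    have a: "0 < a" "a \<le> 1/3" using rexp_bounds[of r] by (auto simp: a_def)
    \<comment> \<open>A part \<open>2 * a\<close> of the exponent is spent on the assumed smallness;
      the remaining power goes into the Renyi sum. The factors \<open>v powr a\<close> and, from the
      influence, \<open>v powr (1 - a)\<close> recombine to \<open>v\<close>.\<close>
    have "(fcoef V f S)\<^sup>2 \<le> (1 + N) powr (- 316) * v powr a * \<bar>fcoef V f S\<bar> powr (2 - 2 * a)"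
      if S: "S \<in> \<G> r" for S
    proof (cases "fcoef V f S = 0")
      case False
      have "(fcoef V f S)\<^sup>2 = \<bar>fcoef V f S\<bar> powr (2 * a + (2 - 2 * a))" using False by simp
      also have "\<dots> = \<bar>fcoef V f S\<bar> powr (2 * a) * \<bar>fcoef V f S\<bar> powr (2 - 2 * a)" by (rule powr_add)
      also have "\<dots> \<le> ((1 + N) powr (- 316) * v powr a) * \<bar>fcoef V f S\<bar> powr (2 - 2 * a)"
      proof (rule mult_right_mono)
        have "\<bar>fcoef V f S\<bar> powr (2 * a)
            \<le> (2 powr (- (coef_const * real (card S) * ln (1 + N))) * sqrt v) powr (2 * a)"
          using S a by (intro powr_mono2 small) (auto simp: \<G>_def)
        also have "\<dots> = 2 powr (- (coef_const * real (card S) * ln (1 + N)) * (2 * a)) * v powr a"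
          using v by (simp add: powr_mult powr_powr flip: powr_half_sqrt)
        also have "\<dots> \<le> (1 + N) powr (- 316) * v powr a"
        proof (rule mult_right_mono)
          have "316 * ln (1 + N) * 1 \<le> 316 * ln (1 + N) * (2 ^ 38 * (real (card S) * a))"
            using S N1 unfolding \<G>_def a_def by (intro mult_left_mono) auto
          also have "\<dots> = ln 2 * (coef_const * real (card S) * ln (1 + N) * (2 * a))"
            by (simp add: coef_const_def)
          finally show "2 powr (- (coef_const * real (card S) * ln (1 + N)) * (2 * a)) \<le> (1 + N) powr (- 316)"
            using N1 by (simp add: powr_def mult_ac)
        qed simp
        finally show "\<bar>fcoef V f S\<bar> powr (2 * a) \<le> (1 + N) powr (- 316) * v powr a" .
      qed simp
      finally show ?thesis .
    qed simp
    then have "(\<Sum>S\<in>\<G> r. (fcoef V f S)\<^sup>2)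
        \<le> (\<Sum>S\<in>\<G> r. (1 + N) powr (- 316) * v powr a * \<bar>fcoef V f S\<bar> powr (2 - 2 * a))"
      by (rule sum_mono)
    also have "\<dots> = (1 + N) powr (- 316) * v powr a * (\<Sum>S\<in>\<G> r. \<bar>fcoef V f S\<bar> powr (2 - 2 * a))"
      by (simp add: sum_distrib_left)
    also have "\<dots> \<le> (1 + N) powr (- 316) * v powr a * renyi V (\<kappa> r) a f"
      unfolding renyi_def using V by (intro mult_left_mono sum_mono2) (auto simp: \<G>_def levels_def)
    also have "\<dots> \<le> (1 + N) powr (- 316) * v powr a * (125 ^ (r + 1) * infl V f) powr (1 - a)"
      unfolding a_def using renyi_scale_le[OF \<kappa>(1,2) split V f] by (intro mult_left_mono) auto
    also have "\<dots> = (1 + N) powr (- 316) * (v powr a * v powr (1 - a)) * (125 ^ (r + 1) * N) powr (1 - a)"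
      using v by (simp add: I powr_mult mult_ac)
    also have "v powr a * v powr (1 - a) = v" using v by (simp flip: powr_add)
    also have "(1 + N) powr (- 316) * v * (125 ^ (r + 1) * N) powr (1 - a)
        \<le> (1 + N) powr (- 316) * v * (125 ^ (r + 1) * (1 + N))"
    proof (rule mult_left_mono)
      have "1 * 1 \<le> 125 ^ (r + 1) * N" using N1 by (intro mult_mono one_le_power) auto
      then have "(125 ^ (r + 1) * N) powr (1 - a) \<le> (125 ^ (r + 1) * N) powr 1"
        using a by (intro powr_mono) auto
      also have "\<dots> \<le> 125 ^ (r + 1) * (1 + N)" using N1 by simp
      finally show "(125 ^ (r + 1) * N) powr (1 - a) \<le> 125 ^ (r + 1) * (1 + N)" .
    qed (use v in simp)
    also have "\<dots> = ((1 + N) powr (- 316) * (1 + N) powr 1) * v * 125 ^ (r + 1)"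
      using N1 by simp
    also have "(1 + N) powr (- 316) * (1 + N) powr 1 = (1 + N) powr (- 315)"
      by (simp only: powr_add [symmetric]) simp
    finally show ?thesis .
  qed
  have "v / 2 \<le> (\<Sum>S\<in>levels V K. (fcoef V f S)\<^sup>2)"
    using low_level_weight_ge[OF V pos] by (simp add: v_def K_def N)
  also have "\<dots> \<le> (\<Sum>S\<in>levels V K. \<Sum>r\<in>{..R}. if S \<in> \<G> r then (fcoef V f S)\<^sup>2 else 0)"
  proof (rule sum_mono)
    fix S assume "S \<in> levels V K"
    from cover[OF this] obtain r where r: "r \<in> {..R}" "S \<in> \<G> r" by auto
    have "(if S \<in> \<G> r then (fcoef V f S)\<^sup>2 else 0) \<le> (\<Sum>r\<in>{..R}. if S \<in> \<G> r then (fcoef V f S)\<^sup>2 else 0)"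
      using r by (intro member_le_sum) auto
    then show "(fcoef V f S)\<^sup>2 \<le> (\<Sum>r\<in>{..R}. if S \<in> \<G> r then (fcoef V f S)\<^sup>2 else 0)"
      using r by simp
  qed
  also have "\<dots> = (\<Sum>r\<in>{..R}. \<Sum>S\<in>levels V K. if S \<in> \<G> r then (fcoef V f S)\<^sup>2 else 0)"
    by (rule sum.swap)
  also have "\<dots> = (\<Sum>r\<in>{..R}. \<Sum>S\<in>\<G> r. (fcoef V f S)\<^sup>2)"
  proof (rule sum.cong[OF refl])
    fix r
    have "levels V K \<inter> \<G> r = \<G> r" by (auto simp: \<G>_def)
    then show "(\<Sum>S\<in>levels V K. if S \<in> \<G> r then (fcoef V f S)\<^sup>2 else 0) = (\<Sum>S\<in>\<G> r. (fcoef V f S)\<^sup>2)"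
      using sum.inter_restrict[OF finite_levels[OF V], of "\<lambda>S. (fcoef V f S)\<^sup>2" K "\<G> r"] by simp
  qed
  also have "\<dots> \<le> (\<Sum>r\<in>{..R}. (1 + N) powr (- 315) * v * 125 ^ (R + 1))"
  proof (rule sum_mono)
    fix r assume "r \<in> {..R}"
    then have "(1 + N) powr (- 315) * v * 125 ^ (r + 1) \<le> (1 + N) powr (- 315) * v * 125 ^ (R + 1)"
      using v by (intro mult_left_mono power_increasing) auto
    with scale[of r] show "(\<Sum>S\<in>\<G> r. (fcoef V f S)\<^sup>2) \<le> (1 + N) powr (- 315) * v * 125 ^ (R + 1)"
      by linarith
  qed
  also have "\<dots> = (1 + N) powr (- 315) * v * (real (R + 1) * 125 ^ (R + 1))"
    by (simp add: mult_ac)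
  also have "\<dots> \<le> (1 + N) powr (- 315) * v * (1 + N) powr 312"
  proof (rule mult_left_mono)
    \<comment> \<open>As \<open>2 ^ p\<close> is at most \<open>2 * (1 + N)\<close>, the left side
      is a constant times \<open>(1 + N) ^ 8\<close>. The constant \<open>2 ^ 304\<close> is
      absorbed into a power of \<open>1 + N\<close>, since \<open>N \<ge> 1\<close>.\<close>
    have "real (R + 1) * 125 ^ (R + 1) \<le> 2 ^ (R + 1) * 128 ^ (R + 1)"
      by (intro mult_mono power_mono less_imp_le[OF of_nat_less_two_power]) auto
    also have "\<dots> = (2 * 128) ^ (37 + p)" by (simp only: power_mult_distrib R_def) simp
    also have "\<dots> = (2::real) ^ (8 * (37 + p))" by (simp only: power_mult) simp
    also have "\<dots> = 2 ^ 296 * (2 ^ p) ^ 8" by (simp only: power_add power_mult[symmetric] distrib_left) (simp add: mult.commute)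
    also have "\<dots> \<le> 2 ^ 296 * (2 * (1 + N)) ^ 8"
      using p N1 by (intro mult_left_mono power_mono) auto
    also have "\<dots> = 2 ^ 304 * (1 + N) ^ 8" by (simp only: power_mult_distrib mult.assoc[symmetric] power_add[symmetric]) simp
    also have "\<dots> \<le> (1 + N) ^ 304 * (1 + N) ^ 8"
      using N1 by (intro mult_right_mono power_mono) auto
    also have "\<dots> = (1 + N) ^ 312" by (simp only: power_add[symmetric]) simp
    also have "\<dots> = (1 + N) powr 312" using N1 by (simp add: powr_numeral)
    finally show "real (R + 1) * 125 ^ (R + 1) \<le> (1 + N) powr 312" .
  qed (use v in simp)
  also have "\<dots> = v * ((1 + N) powr (- 315) * (1 + N) powr 312)" by (simp only: mult_ac)
  also have "\<dots> = v * (1 + N) powr (- 3)" by (simp only: powr_add[symmetric]) simp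
  also have "\<dots> \<le> v * 2 powr (- 3)"
    using v N1 by (intro mult_left_mono powr_mono2') auto
  also have "\<dots> < v / 2" using v by (simp add: powr_minus)
  finally show False by simp
qed

text \<open>Serves to bound the variance below in the min-entropy estimate. Levels up to
  \<open>2 * N\<close>, including level 0, carry at least half of the mean, whereas by
  hypercontractivity a low-degree part this heavy is impossible for a 0/1 function of very small
  mean.\<close>

lemma mean_ge:
  assumes V: "finite V" and f: "f ` Pow V \<subseteq> {0, 1}" and pos: "0 < weight V f"
    and N: "N = infl V f / weight V f"
  shows "weight V f = fcoef V f {} * (1 - fcoef V f {})" "1 \<le> 4 * 9 powr (2 * N) * fcoef V f {}"
proof -
  define \<mu> where "\<mu> = fcoef V f {}"
  have f01: "f X = 0 \<or> f X = 1" if "X \<subseteq> V" for X using f that by (auto simp: image_subset_iff)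
  have \<mu>: "\<mu> = avg V f" by (simp add: \<mu>_def fcoef_def)
  have "avg V (\<lambda>X. (f X)\<^sup>2) = \<mu>" unfolding \<mu>
  proof (rule avg_cong)
    fix X assume "X \<subseteq> V"
    from f01[OF this] show "(f X)\<^sup>2 = f X" by auto
  qed
  moreover have "(\<Sum>S\<in>Pow V. (fcoef V f S)\<^sup>2) = \<mu>\<^sup>2 + weight V f"
    unfolding weight_def \<mu>_def using V by (subst sum.remove[of _ "{}"]) auto
  ultimately have w: "weight V f = \<mu> - \<mu>\<^sup>2" using parseval[OF V, of f] by simp
  then show "weight V f = fcoef V f {} * (1 - fcoef V f {})"
    by (simp add: \<mu>_def power2_eq_square algebra_simps)
  have \<mu>pos: "\<mu> > 0" using w pos by (smt (verit) zero_le_power2)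
  have N1: "N \<ge> 1" using weight_le_infl[OF V, of f] pos by (simp add: N)
  define K where "K = nat \<lfloor>2 * N\<rfloor>"
  define Q where "Q = (\<Sum>S\<in>insert {} (levels V K). (fcoef V f S)\<^sup>2)"
  have "Q = \<mu>\<^sup>2 + (\<Sum>S\<in>levels V K. (fcoef V f S)\<^sup>2)"
    unfolding Q_def \<mu>_def using V by (subst sum.insert) (auto simp: finite_levels levels_def)
  also have "\<dots> \<ge> \<mu>\<^sup>2 + weight V f / 2"
    using low_level_weight_ge[OF V pos] by (simp add: K_def N)
  finally have "\<mu> / 2 \<le> Q" using w zero_le_power2[of \<mu>] by linarith
  \<comment> \<open>The exponent \<open>b = 1/3\<close> is the extreme admissible one; any power of
    \<open>f\<close> is \<open>f\<close>, so the right side is linear in the mean and cubing leaves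
    a spare factor.\<close>
  then have "(\<mu> / 2) powr (1 - 1/3) \<le> Q powr (1 - 1/3)" using \<mu>pos by (intro powr_mono2) auto
  also have "\<dots> \<le> 9 powr (real K * (1/3)) * avg V (\<lambda>X. \<bar>f X\<bar> powr (2 - 2 * (1/3)))"
    unfolding Q_def using V by (intro low_level_weight_powr_le) (auto simp: levels_def)
  also have "avg V (\<lambda>X. \<bar>f X\<bar> powr (2 - 2 * (1/3))) = \<mu>"
    unfolding \<mu>
  proof (rule avg_cong)
    fix X assume "X \<subseteq> V"
    from f01[OF this] show "\<bar>f X\<bar> powr (2 - 2 * (1/3)) = f X" by auto
  qed
  finally have "((\<mu> / 2) powr (1 - 1/3)) powr 3 \<le> (9 powr (real K * (1/3)) * \<mu>) powr 3"
    by (intro powr_mono2) auto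
  then have "(\<mu> / 2)\<^sup>2 \<le> 9 powr real K * \<mu> ^ 3"
    using \<mu>pos by (simp add: powr_mult powr_powr powr_numeral)
  then have "1 * \<mu>\<^sup>2 \<le> (4 * 9 powr real K * \<mu>) * \<mu>\<^sup>2"
    by (simp add: power2_eq_square power3_eq_cube field_simps)
  then have "1 \<le> 4 * 9 powr real K * \<mu>"
    using \<mu>pos by (simp only: mult_le_cancel_right) auto
  also have "\<dots> \<le> 4 * 9 powr (2 * N) * \<mu>"
    using \<mu>pos N1 unfolding K_def by (intro mult_right_mono mult_left_mono powr_mono) auto
  finally show "1 \<le> 4 * 9 powr (2 * N) * fcoef V f {}" by (simp add: \<mu>_def)
qed

section \<open>Transfer to the cube of 0/1 sequences\<close>

definition point :: "nat \<Rightarrow> nat set \<Rightarrow> nat \<Rightarrow> nat" where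
  "point n X = (\<lambda>i\<in>{1..n}. of_bool (i \<in> X))"

lemma bij_betw_point: "bij_betw (point n) (Pow {1..n}) (bcube n)"
proof (rule bij_betw_byWitness[where f' = "\<lambda>x. {i \<in> {1..n}. x i = 1}"])
  show "\<forall>x\<in>bcube n. point n {i \<in> {1..n}. x i = 1} = x"
  proof
    fix x assume "x \<in> bcube n"
    then have x: "\<And>i. i \<in> {1..n} \<Longrightarrow> x i \<in> {0, 1}" "x \<in> extensional {1..n}"
      unfolding bcube_def by (auto simp: PiE_iff)
    show "point n {i \<in> {1..n}. x i = 1} = x"
    proof (rule extensionalityI[OF _ x(2)])
      fix i assume "i \<in> {1..n}"
      then show "point n {i \<in> {1..n}. x i = 1} i = x i" using x(1)[of i] by (auto simp: point_def)
    qed (simp add: point_def)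
  qed
qed (auto simp: point_def bcube_def)

lemma cube_mean_eq_avg: "cube_mean n h = avg {1..n} (\<lambda>X. h (point n X))"
proof -
  have "card (bcube n) = 2 ^ n"
    using bij_betw_same_card[OF bij_betw_point[of n]] by (simp add: card_Pow)
  moreover have "(\<Sum>x\<in>bcube n. h x) = (\<Sum>X\<in>Pow {1..n}. h (point n X))"
    by (rule sum.reindex_bij_betw[OF bij_betw_point, symmetric])
  ultimately show ?thesis by (simp add: cube_mean_def avg_def)
qed

lemma walsh_point:
  assumes "S \<subseteq> {1..n}"
  shows "walsh S (point n X) = chi S X"
proof -
  have fin: "finite S" using assms by (rule finite_subset) simp
  have "(\<Sum>i\<in>S. point n X i) = (\<Sum>i\<in>S. if i \<in> X then 1 else 0)"
    using assms by (intro sum.cong) (auto simp: point_def of_bool_def)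
  also have "\<dots> = card (S \<inter> X)" using fin by (simp flip: sum.inter_restrict)
  finally show ?thesis by (simp add: walsh_def chi_def)
qed

lemma fourier_coeff_eq_fcoef:
  "S \<subseteq> {1..n} \<Longrightarrow> fourier_coeff n f S = fcoef {1..n} (\<lambda>X. f (point n X)) S"
  by (simp add: fourier_coeff_def cube_inner_def cube_mean_eq_avg fcoef_def walsh_point)

lemma total_influence_eq_infl: "total_influence n f = infl {1..n} (\<lambda>X. f (point n X))"
  by (simp add: total_influence_def infl_def fourier_coeff_eq_fcoef)

lemma cube_var_eq_weight: "cube_var n f = weight {1..n} (\<lambda>X. f (point n X))"
proof -
  define g where "g X = f (point n X)" for X
  have "avg {1..n} (\<lambda>X. (g X)\<^sup>2) = (fcoef {1..n} g {})\<^sup>2 + weight {1..n} g"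
    unfolding weight_def by (subst parseval, simp, subst sum.remove[of _ "{}"]) auto
  moreover have "fcoef {1..n} g {} = avg {1..n} g" by (simp add: fcoef_def)
  ultimately show ?thesis
    by (simp add: cube_var_def cube_mean_eq_avg g_def [abs_def])
qed

text \<open>If all coefficients at nonempty sets vanish, Fourier inversion leaves only the constant
  term.\<close>

lemma weight_pos_if_nonconstant:
  assumes "\<not> f constant_on bcube n"
  shows "0 < weight {1..n} (\<lambda>X. f (point n X))"
proof (rule ccontr)
  define g where "g X = f (point n X)" for X
  assume "\<not> ?thesis"
  then have "(\<Sum>S\<in>Pow {1..n} - {{}}. (fcoef {1..n} g S)\<^sup>2) \<le> 0"
    by (simp add: weight_def g_def [abs_def] not_less)
  then have "(\<Sum>S\<in>Pow {1..n} - {{}}. (fcoef {1..n} g S)\<^sup>2) = 0"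
    by (intro antisym sum_nonneg) auto
  then have "\<forall>S\<in>Pow {1..n} - {{}}. (fcoef {1..n} g S)\<^sup>2 = 0"
    by (subst (asm) sum_nonneg_eq_0_iff) auto
  then have zero: "fcoef {1..n} g S = 0" if "S \<in> Pow {1..n} - {{}}" for S
    using that by (metis power_eq_0_iff)
  have "g X = fcoef {1..n} g {}" if "X \<subseteq> {1..n}" for X
  proof -
    have "g X = (\<Sum>S\<in>Pow {1..n}. fcoef {1..n} g S * chi S X)"
      using that by (intro fourier_inversion) auto
    also have "\<dots> = fcoef {1..n} g {} + (\<Sum>S\<in>Pow {1..n} - {{}}. fcoef {1..n} g S * chi S X)"
      by (subst sum.remove[of _ "{}"]) auto
    also have "(\<Sum>S\<in>Pow {1..n} - {{}}. fcoef {1..n} g S * chi S X) = 0"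
      by (intro sum.neutral ballI) (simp only: zero mult_zero_left)
    finally show ?thesis by simp
  qed
  then have "\<forall>x\<in>point n ` Pow {1..n}. f x = fcoef {1..n} g {}"
    by (simp add: g_def)
  then show False
    using assms unfolding bij_betw_imp_surj_on[OF bij_betw_point] constant_on_def by blast
qed

lemma log_recip_square_le:
  assumes "0 < c" "c \<le> \<bar>x\<bar>" "- 2 * ln c \<le> B"
  shows "log_recip (x\<^sup>2) \<le> ereal B"
proof -
  have "x \<noteq> 0" using assms by auto
  have "ln (1 / x\<^sup>2) = - 2 * ln \<bar>x\<bar>"
    using \<open>x \<noteq> 0\<close> ln_realpow[of "\<bar>x\<bar>" 2] by (simp add: ln_div)
  also have "\<dots> \<le> - 2 * ln c" using assms by simp
  finally show ?thesis using assms \<open>x \<noteq> 0\<close> by (simp add: log_recip_def)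
qed

theorem theorem1p1:
  shows "(\<exists>C C' :: real. C > 0 \<and> C' > 0 \<and>
      (\<forall>(n :: nat) (f :: (nat \<Rightarrow> nat) \<Rightarrow> real).
        f \<in> bcube n \<rightarrow> {0, 1} \<and> \<not> f constant_on bcube n \<longrightarrow>
        (\<exists>S. S \<noteq> {} \<and> S \<subseteq> {1..n} \<and>
             real (card S) \<le> C' * norm_influence n f \<and>
             \<bar>fourier_coeff n f S\<bar> \<ge>
               2 powr (- (C * real (card S) * ln (1 + norm_influence n f))) * sqrt (cube_var n f))))
    \<and> (\<exists>K :: real. K > 0 \<and>
      (\<forall>(n :: nat) (f :: (nat \<Rightarrow> nat) \<Rightarrow> real).
        f \<in> bcube n \<rightarrow> {0, 1} \<and> \<not> f constant_on bcube n \<longrightarrow>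
        fourier_min_entropy n f \<le> ereal (K * (norm_influence n f * ln (1 + norm_influence n f)))))"
proof -
  have basic: "(\<lambda>X. f (point n X)) ` Pow {1..n} \<subseteq> {0, 1}" "0 < weight {1..n} (\<lambda>X. f (point n X))"
    "norm_influence n f = infl {1..n} (\<lambda>X. f (point n X)) / weight {1..n} (\<lambda>X. f (point n X))"
    if f: "f \<in> bcube n \<rightarrow> {0, 1} \<and> \<not> f constant_on bcube n" for n f
  proof -
    have "f ` point n ` Pow {1..n} \<subseteq> {0, 1}"
      using f unfolding bij_betw_imp_surj_on[OF bij_betw_point] by (simp only: image_subset_iff_funcset)
    then show "(\<lambda>X. f (point n X)) ` Pow {1..n} \<subseteq> {0, 1}" by (simp only: image_image)
    show "0 < weight {1..n} (\<lambda>X. f (point n X))" using f by (intro weight_pos_if_nonconstant) simp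
    show "norm_influence n f = infl {1..n} (\<lambda>X. f (point n X)) / weight {1..n} (\<lambda>X. f (point n X))"
      by (simp only: norm_influence_def total_influence_eq_infl cube_var_eq_weight)
  qed
  have coef: "\<exists>S. S \<noteq> {} \<and> S \<subseteq> {1..n} \<and> real (card S) \<le> 2 * norm_influence n f \<and>
      \<bar>fourier_coeff n f S\<bar> \<ge>
        2 powr (- (coef_const * real (card S) * ln (1 + norm_influence n f))) * sqrt (cube_var n f)"
    if f: "f \<in> bcube n \<rightarrow> {0, 1} \<and> \<not> f constant_on bcube n" for n f
  proof -
    obtain S where S: "S \<noteq> {}" "S \<subseteq> {1..n}" "real (card S) \<le> 2 * norm_influence n f"
      "2 powr (- (coef_const * real (card S) * ln (1 + norm_influence n f)))
        * sqrt (weight {1..n} (\<lambda>X. f (point n X))) \<le> \<bar>fcoef {1..n} (\<lambda>X. f (point n X)) S\<bar>"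
      using exists_large_fcoef[OF _ basic[OF f]] by auto
    then show ?thesis
      unfolding cube_var_eq_weight using fourier_coeff_eq_fcoef[OF S(2), of f] by (intro exI[of _ S]) simp
  qed
  \<comment> \<open>The first summand pays for the power of 2 in the coefficient bound, squared and
    with \<open>card S \<le> 2 * N\<close>. The second pays for the variance, through
    \<open>- ln v \<le> (2 * ln 9 + ln 8) * N\<close> and
    \<open>ln 2 \<le> ln (1 + N)\<close>.\<close>
  define K where "K = 4 * ln 2 * coef_const + (2 * ln 9 + ln 8) / ln 2"
  have "fourier_min_entropy n f \<le> ereal (K * (norm_influence n f * ln (1 + norm_influence n f)))"
    if f: "f \<in> bcube n \<rightarrow> {0, 1} \<and> \<not> f constant_on bcube n" for n f
  proof -
    define N where "N = norm_influence n f"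
    define v where "v = cube_var n f"
    define \<mu> where "\<mu> = fourier_coeff n f {}"
    have v: "v > 0" using basic(2)[OF f] by (simp add: v_def cube_var_eq_weight)
    \<comment> \<open>This allows additive constants to be absorbed into multiples of
      \<open>N\<close>.\<close>
    have N1: "N \<ge> 1"
      using basic(2)[OF f] weight_le_infl[of "{1..n}" "\<lambda>X. f (point n X)"]
      by (simp add: N_def basic(3)[OF f])
    have v\<mu>: "v = \<mu> * (1 - \<mu>)" and \<mu>: "1 \<le> 4 * 9 powr (2 * N) * \<mu>"
      using mean_ge[OF _ basic[OF f]] unfolding v_def \<mu>_def N_def
      by (simp_all add: cube_var_eq_weight fourier_coeff_eq_fcoef)
    have NL: "N * ln 2 \<le> N * ln (1 + N)" using N1 by (intro mult_left_mono) auto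
    have bound: "fourier_min_entropy n f \<le> ereal B" if "S \<subseteq> {1..n}" "log_recip ((fourier_coeff n f S)\<^sup>2) \<le> ereal B" for S B
      unfolding fourier_min_entropy_def using that by (meson Min_le finite_Pow_iff finite_atLeastAtMost
          finite_imageI image_eqI Pow_iff order_trans)
    have C: "4 * ln 2 * coef_const * (N * ln (1 + N)) \<ge> 0" using N1 coef_const_pos by simp
    have M: "(2 * ln 9 + ln 8) * N \<le> (2 * ln 9 + ln 8) / ln 2 * (N * ln (1 + N))"
      using NL mult_left_mono[OF NL, of "(2 * ln 9 + ln 8) / ln 2"] by simp
    have Keq: "K * (N * ln (1 + N))
        = 4 * ln 2 * coef_const * (N * ln (1 + N)) + (2 * ln 9 + ln 8) / ln 2 * (N * ln (1 + N))"
      by (simp add: K_def algebra_simps)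
    have ln8: "ln 8 = 3 * ln (2::real)" using ln_realpow[of 2 3] by simp
    have ln9: "ln (9::real) > 0" by simp
    show ?thesis
    \<comment> \<open>For a large mean the empty set already witnesses bounded min-entropy.
      Otherwise the variance is at least half the mean, which \<open>mean_ge\<close> bounds
      below.\<close>
    proof (cases "\<mu> \<ge> 1/2")
      case True
      have "- 2 * ln (1/2) \<le> K * (N * ln (1 + N))"
      proof -
        have "2 * ln (2::real) \<le> (2 * ln 9 + ln 8) * 1" using ln8 ln9 by simp
        also have "\<dots> \<le> (2 * ln 9 + ln 8) * N" using N1 by (intro mult_left_mono) auto
        finally have "2 * ln 2 \<le> K * (N * ln (1 + N))" using M C Keq by linarith
        then show ?thesis by (simp add: ln_div)
      qed
      then show ?thesis
        using True unfolding N_def \<mu>_def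
        by (intro bound[of "{}"] log_recip_square_le[of "1/2"]) auto
    next
      case False
      obtain S where S: "S \<noteq> {}" "S \<subseteq> {1..n}" "real (card S) \<le> 2 * N"
        "2 powr (- (coef_const * real (card S) * ln (1 + N))) * sqrt v \<le> \<bar>fourier_coeff n f S\<bar>"
        using coef[OF f] unfolding N_def v_def by blast
      define c where "c = 2 powr (- (coef_const * real (card S) * ln (1 + N))) * sqrt v"
      have "- 2 * ln c = 2 * ln 2 * (coef_const * real (card S) * ln (1 + N)) - ln v"
        unfolding c_def using v by (simp add: ln_mult ln_powr ln_sqrt)
      also have "\<dots> \<le> 2 * ln 2 * (coef_const * (2 * N) * ln (1 + N)) + (2 * ln 9 + ln 8) * N"
      proof -
        have "\<mu> > 0" using \<mu> by (smt (verit) mult_nonneg_nonpos powr_ge_zero)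
        have "- ln v \<le> ln (8 * 9 powr (2 * N))"
        proof -
          have "\<mu> * (1/2) \<le> v" unfolding v\<mu> using False \<open>\<mu> > 0\<close> by (intro mult_left_mono) auto
          then have "8 * 9 powr (2 * N) * (\<mu> * (1/2)) \<le> 8 * 9 powr (2 * N) * v"
            by (intro mult_left_mono) auto
          moreover have "8 * 9 powr (2 * N) * (\<mu> * (1/2)) = 4 * 9 powr (2 * N) * \<mu>" by simp
          ultimately have "1 \<le> 8 * 9 powr (2 * N) * v" using \<mu> by linarith
          then have "0 \<le> ln (8 * 9 powr (2 * N) * v)" by simp
          then show ?thesis using v by (simp add: ln_mult)
        qed
        also have "\<dots> = ln 8 * 1 + 2 * ln 9 * N" by (simp add: ln_mult ln_powr)
        also have "\<dots> \<le> ln 8 * N + 2 * ln 9 * N" using N1 by (intro add_right_mono mult_left_mono) auto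
        also have "\<dots> = (2 * ln 9 + ln 8) * N" by (simp add: algebra_simps)
        finally have "- ln v \<le> (2 * ln 9 + ln 8) * N" .
        moreover have "2 * ln 2 * (coef_const * real (card S) * ln (1 + N))
            \<le> 2 * ln 2 * (coef_const * (2 * N) * ln (1 + N))"
          using S(3) N1 coef_const_pos by (intro mult_left_mono mult_right_mono) auto
        ultimately show ?thesis by linarith
      qed
      also have "\<dots> \<le> K * (N * ln (1 + N))"
      proof -
        have "2 * ln 2 * (coef_const * (2 * N) * ln (1 + N)) = 4 * ln 2 * coef_const * (N * ln (1 + N))"
          by simp
        then show ?thesis using M Keq by linarith
      qed
      finally have "- 2 * ln c \<le> K * (N * ln (1 + N))" .
      moreover have "c > 0" using v by (simp add: c_def)
      ultimately show ?thesis
        using S unfolding N_def c_def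
        by (intro bound[of S] log_recip_square_le[of c]) (auto simp: N_def c_def)
    qed
  qed
  moreover have "K > 0"
    unfolding K_def using coef_const_pos by (intro add_pos_pos mult_pos_pos divide_pos_pos) auto
  moreover have "(2::real) > 0" by simp
  ultimately show ?thesis using coef coef_const_pos by blast
qed

end
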